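(* Suppose that $V(r,z)=\|z-r\|^2/2$ for any $r,z\in Z$, where $\|\cdot\|$ is the norm induced by the inner product, that the bounded variance assumption A1 holds, and that there exists a strong solution $u^*$ of $VI(Z;G,H,J)$; let $D:=\|r_1-u^*\|$ and $\sigma:=\sqrt{\sigma_H^2+\sigma_G^2}$. Let the maximum number of iterations $N\ge2$ and a parameter $\tilde D>0$ be given, and let the stepsizes $\{\alpha_t\}$ and $\{\gamma_t\}$ in the stochastic AMP method be set to $$\alpha_t=\frac2{t+1}\quad\text{and}\quad\gamma_t=\frac{t}{5L_G+3L_HN+\sigma N\sqrt{N-1}/\tilde D}$$ (where the denominator is positive). Then there exist (random) $v_N\in\mathcal E$ and $\varepsilon_N\ge0$ such that $\tilde g(w^{ag}_N,v_N)\le\varepsilon_N$, $$\mathbb E[\|v_N\|]\le\frac{40L_GD}{N(N-1)}+\frac{24L_HD}{N-1}+\frac{\sigma(8D/\tilde D+5)}{\sqrt{N-1}},$$ and $$\mathbb E[\varepsilon_N]\le\frac{90L_GD^2}{N(N-1)}+\frac{54L_HD^2}{N-1}+\frac{\sigma D}{\sqrt{N-1}}\left(\frac{18D}{\tilde D}+\left(19+\frac{18}N\right)\frac{\tilde D}{D}\right),$$ where the last term is read as $\frac{\sigma}{\sqrt{N-1}}\left(\frac{18D^2}{\tilde D}+\left(19+\frac{18}N\right)\tilde D\right)$ (which is the same quantity when $D>0$).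
   Context: Setting. $\mathcal E$ is a finite-dimensional real vector space with inner product $\langle\cdot,\cdot\rangle$ and induced norm $\|\cdot\|$; $Z\subset\mathcal E$ is a nonempty closed convex set (possibly unbounded). $G$ is continuously differentiable with $0\le G(w)-G(v)-\langle\nabla G(v),w-v\rangle\le\frac{L_G}{2}\|w-v\|^2$ for all $w,v\in Z$. $H:Z\to\mathcal E$ satisfies $\langle H(w)-H(v),w-v\rangle\ge0$ and $\|H(w)-H(v)\|\le L_H\|w-v\|$ for all $w,v\in Z$. $J$ is a real-valued convex function on $Z$ having a subgradient $J'(u)\in\partial J(u)$ at each $u\in Z$. $VI(Z;G,H,J)$ is the variational inequality with operator $F(u)=\nabla G(u)+H(u)+J'(u)$; a strong solution is a point $u^*\in Z$ with $\langle F(u^* ),u^*-u\rangle\le0$ for all $u\in Z$. Prox-mapping. For $z\in Z$, $\eta\in\mathcal E$, $\gamma>0$, $P_z^{\gamma J}(\eta)=\operatorname{argmin}_{u\in Z}\{\langle\eta,u-z\rangle+V(z,u)+\gamma J(u)\}$, assumed to be well defined. Stochastic oracles. At the $i$-th call with input $x\in Z$, oracles $\mathcal{SO}_G$ and $\mathcal{SO}_H$ return $\mathcal G(x,\xi_i)$ and $\mathcal H(x,\zeta_i)$, where all $\xi_i,\zeta_i$ are independent random variables and $\mathbb E[\mathcal G(x,\xi_i)]=\nabla G(x)$, $\mathbb E[\mathcal H(x,\zeta_i)]=H(x)$. Assumption A1: $\mathbb E[\|\mathcal G(x,\xi_i)-\nabla G(x)\|^2]\le\sigma_G^2$ and $\mathbb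 E[\|\mathcal H(x,\zeta_i)-H(x)\|^2]\le\sigma_H^2$ for all $x\in Z$ and all $i$. Stochastic AMP method. Choose $r_1\in Z$ and set $w_1=w_1^{ag}=r_1$. For $t=1,2,\ldots,N-1$: $w_t^{md}=(1-\alpha_t)w_t^{ag}+\alpha_tr_t$; $w_{t+1}=P_{r_t}^{\gamma_tJ}(\gamma_t\mathcal H(r_t,\zeta_{2t-1})+\gamma_t\mathcal G(w_t^{md},\xi_t))$; $r_{t+1}=P_{r_t}^{\gamma_tJ}(\gamma_t\mathcal H(w_{t+1},\zeta_{2t})+\gamma_t\mathcal G(w_t^{md},\xi_t))$ (same sample $\mathcal G(w_t^{md},\xi_t)$); $w_{t+1}^{ag}=(1-\alpha_t)w_t^{ag}+\alpha_tw_{t+1}$. Gap function. $Q(\tilde u,u)=G(\tilde u)-G(u)+\langle H(u),\tilde u-u\rangle+J(\tilde u)-J(u)$ for $\tilde u,u\in Z$, and $\tilde g(\tilde u,\tilde v)=\sup_{u\in Z}\{Q(\tilde u,u)-\langle\tilde v,\tilde u-u\rangle\}$ for $\tilde u\in Z$, $\tilde v\in\mathcal E$. *)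

theory Defs
  imports "HOL-Probability.Probability"
begin

definition subgradient_on :: "'a::real_inner set \<Rightarrow> ('a \<Rightarrow> real) \<Rightarrow> 'a \<Rightarrow> 'a \<Rightarrow> bool" where
  "subgradient_on Z J u g \<longleftrightarrow> (\<forall>w\<in>Z. J w \<ge> J u + g \<bullet> (w - u))"

definition strong_solution :: "'a::real_inner set \<Rightarrow> ('a \<Rightarrow> 'a) \<Rightarrow> 'a \<Rightarrow> bool" where
  "strong_solution Z F us \<longleftrightarrow> us \<in> Z \<and> (\<forall>u\<in>Z. F us \<bullet> (us - u) \<le> 0)"

definition prox_objective ::
  "('a::real_inner \<Rightarrow> 'a \<Rightarrow> real) \<Rightarrow> ('a \<Rightarrow> real) \<Rightarrow> real \<Rightarrow> 'a \<Rightarrow> 'a \<Rightarrow> 'a \<Rightarrow> real" where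
  "prox_objective V J \<gamma> z \<eta> u = \<eta> \<bullet> (u - z) + V z u + \<gamma> * J u"

definition prox_mapping ::
  "'a::real_inner set \<Rightarrow> ('a \<Rightarrow> 'a \<Rightarrow> real) \<Rightarrow> ('a \<Rightarrow> real) \<Rightarrow> real \<Rightarrow> 'a \<Rightarrow> 'a \<Rightarrow> 'a" where
  "prox_mapping Z V J \<gamma> z \<eta> = arg_min_on (prox_objective V J \<gamma> z \<eta>) Z"

text \<open>\<^const>\<open>arg_min_on\<close> selects an unspecified value when there is no minimizer and an arbitrary
  minimizer when there are several; the following excludes both.\<close>

definition prox_well_defined ::
  "'a::real_inner set \<Rightarrow> ('a \<Rightarrow> 'a \<Rightarrow> real) \<Rightarrow> ('a \<Rightarrow> real) \<Rightarrow> bool" where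
  "prox_well_defined Z V J \<longleftrightarrow>
     (\<forall>z\<in>Z. \<forall>\<eta>. \<forall>\<gamma>>0. \<exists>!u. is_arg_min (prox_objective V J \<gamma> z \<eta>) (\<lambda>u. u \<in> Z) u)"

definition gap_Q ::
  "('a::real_inner \<Rightarrow> real) \<Rightarrow> ('a \<Rightarrow> 'a) \<Rightarrow> ('a \<Rightarrow> real) \<Rightarrow> 'a \<Rightarrow> 'a \<Rightarrow> real" where
  "gap_Q G H J u' u = G u' - G u + H u \<bullet> (u' - u) + J u' - J u"

text \<open>Extended-real valued, since the supremum may be infinite when \<open>Z\<close> is unbounded.\<close>

definition perturbed_gap ::
  "'a::real_inner set \<Rightarrow> ('a \<Rightarrow> real) \<Rightarrow> ('a \<Rightarrow> 'a) \<Rightarrow> ('a \<Rightarrow> real) \<Rightarrow> 'a \<Rightarrow> 'a \<Rightarrow> ereal" where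
  "perturbed_gap Z G H J u' v' = (SUP u\<in>Z. ereal (gap_Q G H J u' u - v' \<bullet> (u' - u)))"

text \<open>Joint independence of all the \<open>\<xi> i\<close> and \<open>\<zeta> i\<close> with \<open>i \<ge> 1\<close>. This is what
  \<^const>\<open>prob_space.indep_vars\<close> unfolds to, except that the two families may take values in
  different types.\<close>

definition independent_samples ::
  "'w measure \<Rightarrow> 'x measure \<Rightarrow> (nat \<Rightarrow> 'w \<Rightarrow> 'x) \<Rightarrow> 'y measure \<Rightarrow> (nat \<Rightarrow> 'w \<Rightarrow> 'y) \<Rightarrow> bool" where
  "independent_samples M X \<xi> Y \<zeta> \<longleftrightarrow>
     (\<forall>i\<ge>1. \<xi> i \<in> measurable M X) \<and> (\<forall>i\<ge>1. \<zeta> i \<in> measurable M Y) \<and>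
     prob_space.indep_sets M
       (case_sum (\<lambda>i. {\<xi> i -` A \<inter> space M | A. A \<in> sets X})
                 (\<lambda>i. {\<zeta> i -` A \<inter> space M | A. A \<in> sets Y}))
       ({1..} <+> {1..})"

definition unbiased_oracle ::
  "'a::euclidean_space set \<Rightarrow> 'w measure \<Rightarrow> 'x measure \<Rightarrow> (nat \<Rightarrow> 'w \<Rightarrow> 'x)
    \<Rightarrow> ('a \<Rightarrow> 'x \<Rightarrow> 'a) \<Rightarrow> ('a \<Rightarrow> 'a) \<Rightarrow> bool" where
  "unbiased_oracle Z M X \<xi> O\<^sub>F F \<longleftrightarrow>
     (\<lambda>(x, s). O\<^sub>F x s) \<in> borel_measurable (restrict_space borel Z \<Otimes>\<^sub>M X) \<and>
     (\<forall>x\<in>Z. \<forall>i\<ge>1. integrable M (\<lambda>\<omega>. O\<^sub>F x (\<xi> i \<omega>)) \<and> (\<integral>\<omega>. O\<^sub>F x (\<xi> i \<omega>) \<partial>M) = F x)"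

definition bounded_variance ::
  "'a::euclidean_space set \<Rightarrow> 'w measure \<Rightarrow> (nat \<Rightarrow> 'w \<Rightarrow> 'x)
    \<Rightarrow> ('a \<Rightarrow> 'x \<Rightarrow> 'a) \<Rightarrow> ('a \<Rightarrow> 'a) \<Rightarrow> real \<Rightarrow> bool" where
  "bounded_variance Z M \<xi> O\<^sub>F F s \<longleftrightarrow>
     (\<forall>x\<in>Z. \<forall>i\<ge>1. integrable M (\<lambda>\<omega>. (norm (O\<^sub>F x (\<xi> i \<omega>) - F x))\<^sup>2) \<and>
       (\<integral>\<omega>. (norm (O\<^sub>F x (\<xi> i \<omega>) - F x))\<^sup>2 \<partial>M) \<le> s\<^sup>2)"

text \<open>One run of the method for given sample values \<open>\<xi> i\<close>, \<open>\<zeta> i\<close>.\<close>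

definition stochastic_AMP ::
  "'a::real_inner set \<Rightarrow> ('a \<Rightarrow> 'a \<Rightarrow> real) \<Rightarrow> ('a \<Rightarrow> real)
    \<Rightarrow> ('a \<Rightarrow> 'x \<Rightarrow> 'a) \<Rightarrow> ('a \<Rightarrow> 'y \<Rightarrow> 'a) \<Rightarrow> (nat \<Rightarrow> real) \<Rightarrow> (nat \<Rightarrow> real) \<Rightarrow> nat \<Rightarrow> 'a
    \<Rightarrow> (nat \<Rightarrow> 'x) \<Rightarrow> (nat \<Rightarrow> 'y)
    \<Rightarrow> (nat \<Rightarrow> 'a) \<Rightarrow> (nat \<Rightarrow> 'a) \<Rightarrow> (nat \<Rightarrow> 'a) \<Rightarrow> (nat \<Rightarrow> 'a) \<Rightarrow> bool" where
  "stochastic_AMP Z V J O\<^sub>G O\<^sub>H \<alpha> \<gamma> N r1 \<xi> \<zeta> r w w_md w_ag \<longleftrightarrow>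
     r 1 = r1 \<and> w 1 = r1 \<and> w_ag 1 = r1 \<and>
     (\<forall>t\<in>{1..<N}.
        w_md t = (1 - \<alpha> t) *\<^sub>R w_ag t + \<alpha> t *\<^sub>R r t \<and>
        w (t + 1) = prox_mapping Z V J (\<gamma> t) (r t)
          (\<gamma> t *\<^sub>R O\<^sub>H (r t) (\<zeta> (2 * t - 1)) + \<gamma> t *\<^sub>R O\<^sub>G (w_md t) (\<xi> t)) \<and>
        r (t + 1) = prox_mapping Z V J (\<gamma> t) (r t)
          (\<gamma> t *\<^sub>R O\<^sub>H (w (t + 1)) (\<zeta> (2 * t)) + \<gamma> t *\<^sub>R O\<^sub>G (w_md t) (\<xi> t)) \<and>
        w_ag (t + 1) = (1 - \<alpha> t) *\<^sub>R w_ag t + \<alpha> t *\<^sub>R w (t + 1))"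

end

theory Submission
  imports Defs
begin

text \<open>Write \<open>c\<close> for the denominator in \<open>\<gamma>\<close>, so that \<open>\<gamma> t = t / c\<close>, and \<open>\<Delta> t\<close> for the sum of the oracle
  errors of \<open>H\<close> at \<open>w (t + 1)\<close> and of \<open>gradG\<close> at \<open>w_md t\<close>. The three-point inequality of the prox-mapping
  and the smoothness of \<open>G\<close> give a telescoping energy inequality for
  \<open>t (t - 1) / 2 * Q (w_ag t) u + c / 2 * \<parallel>r t - u\<parallel>\<^sup>2\<close>, whose remainder consists of squared oracle errors,
  a negative multiple of \<open>\<parallel>w (t + 1) - r t\<parallel>\<^sup>2\<close> and \<open>- t * (\<Delta> t \<bullet> (w (t + 1) - u))\<close>. In the summed inequality
  \<open>u\<close> enters only affinely once the term \<open>\<parallel>r1 - u\<parallel>\<^sup>2 - \<parallel>r N - u\<parallel>\<^sup>2\<close> is expanded around \<open>w_ag N\<close>. Its linear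
  part, which involves \<open>c (r1 - r N)\<close> and the martingale \<open>\<Sum> t \<Delta> t\<close>, is the perturbation \<open>v\<close>; the rest
  is \<open>\<epsilon>\<close>. With the strong solution as \<open>u\<close> the same inequality bounds the second moments of the
  iterates, because \<open>Q\<close> is then nonnegative and the oracle errors are orthogonal to the past.\<close>

text \<open>Since \<open>Z\<close> may be unbounded, no a priori radius controls the iterates, and
  the supremum over \<open>u\<close> sits inside the expectation. Keeping the energy inequality
  pathwise and moving everything linear in \<open>u\<close> into \<open>v\<close> settles all
  \<open>u\<close> at once; only quantities free of \<open>u\<close> are averaged afterwards. With
  \<alpha> = 2/(t+1) the weight t(t+1)/2 satisfies t(t+1)/2 * (1 - \<alpha>) = (t-1)t/2 and t(t+1)/2
  * \<alpha> = t = c * \<gamma>, which is why the averaging of \<open>w_ag\<close> and the prox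
  steps telescope together. The two errors in \<open>\<Delta> t\<close> behave differently. The
  sample of \<open>H\<close> used at \<open>w (t + 1)\<close> is independent of that point, whereas
  the sample of \<open>gradG\<close> already enters \<open>w (t + 1)\<close> and is independent only
  of \<open>r t\<close>. The resulting correlation with the step \<open>w (t + 1) - r t\<close> is
  paid out of the negative quadratic term. The constants 5 and 3 in \<open>c\<close> keep enough of
  that term: smoothness of \<open>G\<close> and the Lipschitz constant of \<open>H\<close> together
  consume at most c/5 of the available c/2.\<close>

lemma inner_le_Young:
  fixes a b :: "'a::real_inner"
  assumes "k > 0"
  shows "a \<bullet> b \<le> (norm a)\<^sup>2 / (2 * k) + k / 2 * (norm b)\<^sup>2"
proof -
  have "0 \<le> (norm (a - k *\<^sub>R b))\<^sup>2" by simp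
  also have "\<dots> = (norm a)\<^sup>2 - 2 * k * (a \<bullet> b) + k\<^sup>2 * (norm b)\<^sup>2"
    unfolding power2_norm_eq_inner by (simp add: inner_simps inner_commute power2_eq_square)
  finally show ?thesis
    using assms by (simp add: field_simps power2_eq_square)
qed

lemma neg_inner_le_Young:
  fixes a b :: "'v::real_inner"
  assumes "k > 0"
  shows "- (s * (a \<bullet> b)) \<le> s\<^sup>2 * (norm a)\<^sup>2 / (2 * k) + k / 2 * (norm b)\<^sup>2"
  using inner_le_Young[OF assms, of "(- s) *\<^sub>R a" b] by (simp add: power_mult_distrib)

lemma power2_norm_add3_le:
  fixes a b c :: "'a::real_inner"
  shows "(norm (a + b - c))\<^sup>2 \<le> 3 * ((norm a)\<^sup>2 + (norm b)\<^sup>2 + (norm c)\<^sup>2)"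
proof -
  \<comment> \<open>These three squares add up to exactly the difference of the two sides.\<close>
  have "0 \<le> (norm (a - b))\<^sup>2 + (norm (a + c))\<^sup>2 + (norm (b + c))\<^sup>2" by simp
  then show ?thesis
    unfolding power2_norm_eq_inner by (simp add: inner_simps inner_commute)
qed

text \<open>Convexity with weights \<open>3/7\<close>, \<open>2/7\<close>, \<open>2/7\<close>, chosen to keep the coefficient of \<open>D\<^sup>2\<close> in the
  bound for \<open>\<epsilon>\<close> below the claimed one.\<close>

lemma norm_add3_sq_le:
  fixes x y z :: "'a::real_inner"
  shows "(norm (x + y + z))\<^sup>2 \<le> 7/3 * (norm x)\<^sup>2 + 7/2 * (norm y)\<^sup>2 + 7/2 * (norm z)\<^sup>2"
proof -
  have xy: "0 \<le> (norm (2 *\<^sub>R x - 3 *\<^sub>R y))\<^sup>2" and xz: "0 \<le> (norm (2 *\<^sub>R x - 3 *\<^sub>R z))\<^sup>2"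
    and yz: "0 \<le> (norm (y - z))\<^sup>2" by simp_all
  have "(norm (x + y + z))\<^sup>2 + (norm (2 *\<^sub>R x - 3 *\<^sub>R y))\<^sup>2 / 6 + (norm (2 *\<^sub>R x - 3 *\<^sub>R z))\<^sup>2 / 6
      + (norm (y - z))\<^sup>2 = 7/3 * (norm x)\<^sup>2 + 7/2 * (norm y)\<^sup>2 + 7/2 * (norm z)\<^sup>2"
    unfolding power2_norm_eq_inner by (simp add: field_simps inner_simps inner_commute)
  with xy xz yz show ?thesis by linarith
qed

section \<open>Power sums of the step weights\<close>

lemma sum_squares_upto:
  assumes "1 \<le> (T::nat)"
  shows "(\<Sum>t\<in>{1..<T}. (real t)\<^sup>2) = (real T - 1) * real T * (2 * real T - 1) / 6"
  using assms
proof (induction T rule: dec_induct)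
  case (step t)
  then show ?case by (simp add: field_simps power2_eq_square)
qed simp

text \<open>The sum grows like 2/5 * T^5. Rounding 2/5 up to 1/2 gives a bound that contains the
  factor \<open>(T - 1) * T / 2\<close>, which later cancels against the total weight of the
  averages.\<close>

lemma sum_quartic_upto_le:
  assumes "1 \<le> (T::nat)"
  shows "(\<Sum>t\<in>{1..<T}. (real t)\<^sup>2 * (real t + 1) * (2 * real t + 1))
    \<le> (real T - 1)\<^sup>2 * (real T)\<^sup>2 * (real T + 1) / 2"
  using assms
proof (induction T rule: dec_induct)
  case (step t)
  have "0 \<le> (real t)\<^sup>2 * (real t + 1) * (real t - 1) / 2" using step by simp
  moreover have "(real t - 1)\<^sup>2 * (real t)\<^sup>2 * (real t + 1) / 2
      + (real t)\<^sup>2 * (real t + 1) * (2 * real t + 1) + (real t)\<^sup>2 * (real t + 1) * (real t - 1) / 2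
      = (real (Suc t) - 1)\<^sup>2 * (real (Suc t))\<^sup>2 * (real (Suc t) + 1) / 2"
    by (simp add: field_simps power2_eq_square)
  moreover have "(\<Sum>t\<in>{1..<Suc t}. (real t)\<^sup>2 * (real t + 1) * (2 * real t + 1))
      = (\<Sum>t\<in>{1..<t}. (real t)\<^sup>2 * (real t + 1) * (2 * real t + 1)) + (real t)\<^sup>2 * (real t + 1) * (2 * real t + 1)"
    using step by simp
  ultimately show ?case using step.IH by linarith
qed simp

section \<open>The prox-mapping\<close>

locale euclidean_prox =
  fixes Z :: "'a::euclidean_space set" and V :: "'a \<Rightarrow> 'a \<Rightarrow> real" and J :: "'a \<Rightarrow> real"
  assumes J_convex: "convex_on Z J"
    and V: "\<And>r z. r \<in> Z \<Longrightarrow> z \<in> Z \<Longrightarrow> V r z = (norm (z - r))\<^sup>2 / 2"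
    and prox: "prox_well_defined Z V J"
begin

lemma is_arg_min_prox_mapping:
  assumes "z \<in> Z" "\<gamma> > 0"
  shows "is_arg_min (prox_objective V J \<gamma> z \<eta>) (\<lambda>u. u \<in> Z) (prox_mapping Z V J \<gamma> z \<eta>)"
proof -
  have "\<exists>u. is_arg_min (prox_objective V J \<gamma> z \<eta>) (\<lambda>u. u \<in> Z) u"
    using prox assms unfolding prox_well_defined_def by blast
  then show ?thesis
    unfolding prox_mapping_def arg_min_on_def arg_min_def by (rule someI_ex)
qed

lemma prox_mapping_in:
  assumes "z \<in> Z" "\<gamma> > 0"
  shows "prox_mapping Z V J \<gamma> z \<eta> \<in> Z"
  using is_arg_min_prox_mapping[OF assms] by (simp add: is_arg_min_def)

text \<open>The objective contains a 1-strongly convex quadratic, so its minimizer beats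
  \<open>u\<close> by half the squared distance. Instead of a first-order optimality condition,
  \<open>p\<close> is compared with the points of the segment towards \<open>u\<close>; dividing by
  the segment parameter \<open>s\<close> and letting it tend to 0 gives the claim.\<close>

lemma prox_mapping_three_point:
  fixes z \<eta> :: 'a
  assumes z: "z \<in> Z" and \<gamma>: "\<gamma> > 0" and u: "u \<in> Z"
  defines "p \<equiv> prox_mapping Z V J \<gamma> z \<eta>"
  shows "\<eta> \<bullet> (p - u) + \<gamma> * (J p - J u)
    \<le> (norm (z - u))\<^sup>2 / 2 - (norm (z - p))\<^sup>2 / 2 - (norm (p - u))\<^sup>2 / 2"
proof -
  have p: "p \<in> Z" using prox_mapping_in[OF z \<gamma>] by (simp add: p_def)
  have min: "prox_objective V J \<gamma> z \<eta> p \<le> prox_objective V J \<gamma> z \<eta> y" if "y \<in> Z" for y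
    using is_arg_min_prox_mapping[OF z \<gamma>, of \<eta>] that by (auto simp: is_arg_min_linorder p_def)
  define gap where "gap = \<eta> \<bullet> (p - u) + \<gamma> * (J p - J u)
    - ((norm (z - u))\<^sup>2 / 2 - (norm (z - p))\<^sup>2 / 2)"
  have *: "gap \<le> - ((1 - s) * ((norm (p - u))\<^sup>2 / 2))" if s: "0 < s" "s < 1" for s :: real
  proof -
    define y where "y = (1 - s) *\<^sub>R p + s *\<^sub>R u"
    have y: "y \<in> Z"
      using convex_on_imp_convex[OF J_convex] p u s by (simp add: y_def convexD_alt)
    have Jy: "\<gamma> * J y \<le> \<gamma> * ((1 - s) * J p + s * J u)"
      using convex_onD[OF J_convex, of s p u] p u s \<gamma> by (simp add: y_def)
    have "\<eta> \<bullet> (p - z) + (norm (p - z))\<^sup>2 / 2 + \<gamma> * J p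
        \<le> \<eta> \<bullet> (y - z) + (norm (y - z))\<^sup>2 / 2 + \<gamma> * J y"
      using min[OF y] V[OF z p] V[OF z y] by (simp add: prox_objective_def)
    moreover have "\<eta> \<bullet> (y - z) = (1 - s) * (\<eta> \<bullet> (p - z)) + s * (\<eta> \<bullet> (u - z))"
      by (simp add: y_def algebra_simps inner_simps)
    moreover have "(norm (y - z))\<^sup>2 = (1 - s) * (norm (p - z))\<^sup>2 + s * (norm (u - z))\<^sup>2
        - s * (1 - s) * (norm (p - u))\<^sup>2"
      unfolding y_def power2_norm_eq_inner by (simp add: algebra_simps inner_simps inner_commute)
    ultimately have "s * (\<eta> \<bullet> (p - z) - \<eta> \<bullet> (u - z) + ((norm (p - z))\<^sup>2 / 2 - (norm (u - z))\<^sup>2 / 2)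
        + (1 - s) * ((norm (p - u))\<^sup>2 / 2) + \<gamma> * (J p - J u)) \<le> 0"
      using Jy by (simp add: field_simps)
    then have "\<eta> \<bullet> (p - z) - \<eta> \<bullet> (u - z) + ((norm (p - z))\<^sup>2 / 2 - (norm (u - z))\<^sup>2 / 2)
        + (1 - s) * ((norm (p - u))\<^sup>2 / 2) + \<gamma> * (J p - J u) \<le> 0"
      using s by (simp add: mult_le_0_iff)
    then show ?thesis
      by (simp add: gap_def norm_minus_commute inner_diff_right)
  qed
  have "gap \<le> - ((1 - 0) * ((norm (p - u))\<^sup>2 / 2))"
  proof (rule tendsto_lowerbound)
    show "((\<lambda>s. - ((1 - s) * ((norm (p - u))\<^sup>2 / 2))) \<longlongrightarrow> - ((1 - 0) * ((norm (p - u))\<^sup>2 / 2)))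
        (at_right 0)"
      by (intro tendsto_intros)
    show "\<forall>\<^sub>F s in at_right 0. gap \<le> - ((1 - s) * ((norm (p - u))\<^sup>2 / 2))"
      by (rule eventually_mono[OF eventually_at_right_real[OF zero_less_one]]) (use * in auto)
  qed simp
  then show ?thesis by (simp add: gap_def)
qed

text \<open>Completing the square shows that the mapping is the proximal map of
  \<open>\<gamma> * J\<close> on \<open>Z\<close> at the centre \<open>z - \<eta>\<close>, which is
  firmly nonexpansive: add the two three-point inequalities, each with the other minimizer as
  comparison point. In particular the value depends on \<open>z\<close> and \<open>\<eta>\<close>
  only through \<open>z - \<eta>\<close>.\<close>

lemma prox_mapping_nonexpansive:
  assumes "z \<in> Z" "z' \<in> Z" "\<gamma> > 0"
  shows "norm (prox_mapping Z V J \<gamma> z \<eta> - prox_mapping Z V J \<gamma> z' \<eta>')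
    \<le> norm ((z - \<eta>) - (z' - \<eta>'))"
proof -
  let ?p = "prox_mapping Z V J \<gamma> z \<eta>" and ?p' = "prox_mapping Z V J \<gamma> z' \<eta>'"
  have "(norm (?p - ?p'))\<^sup>2 \<le> ((z - \<eta>) - (z' - \<eta>')) \<bullet> (?p - ?p')"
    using prox_mapping_three_point[of z \<gamma> ?p' \<eta>] prox_mapping_three_point[of z' \<gamma> ?p \<eta>']
      prox_mapping_in[of z \<gamma> \<eta>] prox_mapping_in[of z' \<gamma> \<eta>'] assms
    unfolding power2_norm_eq_inner
    by (simp add: field_simps inner_simps inner_commute)
  also have "\<dots> \<le> norm ((z - \<eta>) - (z' - \<eta>')) * norm (?p - ?p')"
    by (rule norm_cauchy_schwarz)
  finally show ?thesis
    by (cases "?p = ?p'") (simp_all add: power2_eq_square)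
qed

text \<open>No measurable selection of minimizers is needed: relative to one fixed anchor
  \<open>z\<close>, the value is a 1-Lipschitz function of
  \<open>r \<omega> - \<eta> \<omega>\<close>.\<close>

lemma borel_measurable_prox_mapping:
  assumes \<gamma>: "\<gamma> > 0" and r: "r \<in> borel_measurable A" and \<eta>: "\<eta> \<in> borel_measurable A"
    and rZ: "\<And>\<omega>. \<omega> \<in> space A \<Longrightarrow> r \<omega> \<in> Z"
  shows "(\<lambda>\<omega>. prox_mapping Z V J \<gamma> (r \<omega>) (\<eta> \<omega>)) \<in> borel_measurable A"
proof (cases "space A = {}")
  case True
  then show ?thesis by (simp add: measurable_def)
next
  case False
  then obtain z where z: "z \<in> Z" using rZ by blast
  have cont: "continuous_on UNIV (\<lambda>y. prox_mapping Z V J \<gamma> z (z - y))"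
    unfolding continuous_on_iff
  proof (intro ballI allI impI)
    fix x :: 'a and e :: real assume "e > 0"
    then show "\<exists>d>0. \<forall>x'\<in>UNIV. dist x' x < d \<longrightarrow>
        dist (prox_mapping Z V J \<gamma> z (z - x')) (prox_mapping Z V J \<gamma> z (z - x)) < e"
      using prox_mapping_nonexpansive[OF z z \<gamma>, of "z - _" "z - x"]
      by (intro exI[of _ e]) (auto simp: dist_norm intro: le_less_trans)
  qed
  have eq: "prox_mapping Z V J \<gamma> (r \<omega>) (\<eta> \<omega>) = prox_mapping Z V J \<gamma> z (z - (r \<omega> - \<eta> \<omega>))"
    if "\<omega> \<in> space A" for \<omega>
    using prox_mapping_nonexpansive[OF rZ[OF that] z \<gamma>, of "\<eta> \<omega>" "z - (r \<omega> - \<eta> \<omega>)"] by simp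
  have "(\<lambda>\<omega>. prox_mapping Z V J \<gamma> z (z - (r \<omega> - \<eta> \<omega>))) \<in> borel_measurable A"
    by (rule borel_measurable_continuous_on[OF cont]) (use r \<eta> in measurable)
  then show ?thesis by (simp add: eq cong: measurable_cong)
qed

text \<open>The three-point inequality is used for \<open>r'\<close> against \<open>u\<close> and
  for \<open>w\<close> against \<open>r'\<close>. The terms in \<open>r - r'\<close> cancel in the
  sum, and Young's inequality for \<open>(\<theta> - \<eta>) \<bullet> (w - r')\<close> spends
  exactly the negative square of \<open>w - r'\<close>.\<close>

lemma prox_mapping_extragradient:
  fixes \<eta> \<theta> :: 'a
  assumes r: "r \<in> Z" and \<gamma>: "\<gamma> > 0" and u: "u \<in> Z"
  defines "w \<equiv> prox_mapping Z V J \<gamma> r \<eta>" and "r' \<equiv> prox_mapping Z V J \<gamma> r \<theta>"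
  shows "\<theta> \<bullet> (w - u) + \<gamma> * (J w - J u)
    \<le> (norm (r - u))\<^sup>2 / 2 - (norm (r' - u))\<^sup>2 / 2 - (norm (r - w))\<^sup>2 / 2 + (norm (\<theta> - \<eta>))\<^sup>2 / 2"
proof -
  have "r' \<in> Z" using prox_mapping_in[OF r \<gamma>] by (simp add: r'_def)
  note three_point = prox_mapping_three_point[OF r \<gamma> u, of \<theta>, folded r'_def]
    prox_mapping_three_point[OF r \<gamma> \<open>r' \<in> Z\<close>, of \<eta>, folded w_def]
  have "(\<theta> - \<eta>) \<bullet> (w - r') \<le> (norm (\<theta> - \<eta>))\<^sup>2 / 2 + (norm (w - r'))\<^sup>2 / 2"
    using inner_le_Young[of 1] by simp
  with three_point show ?thesis
    by (simp add: algebra_simps inner_diff_left inner_diff_right)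
qed

end

section \<open>One step of the method\<close>

text \<open>The denominator is an abstract \<open>c\<close> here: one step only needs that it
  dominates the two deterministic terms. Its noise term is exploited at the very end, when the rates
  are simplified.\<close>

locale amp_setting = euclidean_prox Z V J
  for Z :: "'a::euclidean_space set" and V and J +
  fixes G :: "'a \<Rightarrow> real" and gradG H :: "'a \<Rightarrow> 'a" and L\<^sub>G L\<^sub>H c :: real and N :: nat
  assumes G_lower: "\<And>w v. w \<in> Z \<Longrightarrow> v \<in> Z \<Longrightarrow> 0 \<le> G w - G v - gradG v \<bullet> (w - v)"
    and G_upper: "\<And>w v. w \<in> Z \<Longrightarrow> v \<in> Z \<Longrightarrow>
        G w - G v - gradG v \<bullet> (w - v) \<le> L\<^sub>G / 2 * (norm (w - v))\<^sup>2"
    and H_mono: "\<And>w v. w \<in> Z \<Longrightarrow> v \<in> Z \<Longrightarrow> (H w - H v) \<bullet> (w - v) \<ge> 0"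
    and H_lipschitz: "\<And>w v. w \<in> Z \<Longrightarrow> v \<in> Z \<Longrightarrow> norm (H w - H v) \<le> L\<^sub>H * norm (w - v)"
    and L_nonneg: "L\<^sub>G \<ge> 0" "L\<^sub>H \<ge> 0"
    and c_pos: "c > 0"
    and c_ge: "c \<ge> 5 * L\<^sub>G + 3 * L\<^sub>H * N"
begin

abbreviation Q where "Q \<equiv> gap_Q G H J"

lemma convex_Z: "convex Z"
  using J_convex by (rule convex_on_imp_convex)

text \<open>Smoothness is used once, between the new average and \<open>md\<close>, whose difference
  is \<open>\<alpha> *\<^sub>R (w - r)\<close>. The linear model of \<open>G\<close> at
  \<open>md\<close> is then split along the average and bounded by convexity at \<open>a\<close> and
  at \<open>u\<close>. Monotonicity replaces \<open>H u\<close> by \<open>H w\<close>, the value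
  that the oracle estimates.\<close>

lemma gap_Q_averaging:
  assumes in_Z: "a \<in> Z" "r \<in> Z" "w \<in> Z" "u \<in> Z" and \<alpha>: "0 \<le> \<alpha>" "\<alpha> \<le> 1"
  defines "md \<equiv> (1 - \<alpha>) *\<^sub>R a + \<alpha> *\<^sub>R r"
  shows "Q ((1 - \<alpha>) *\<^sub>R a + \<alpha> *\<^sub>R w) u \<le> (1 - \<alpha>) * Q a u
    + \<alpha> * ((gradG md + H w) \<bullet> (w - u) + J w - J u) + L\<^sub>G / 2 * \<alpha>\<^sup>2 * (norm (w - r))\<^sup>2"
proof -
  define a' where "a' = (1 - \<alpha>) *\<^sub>R a + \<alpha> *\<^sub>R w"
  have Z: "md \<in> Z" "a' \<in> Z"
    using convex_Z in_Z \<alpha> by (simp_all add: md_def a'_def convexD_alt)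
  have "norm (a' - md) = \<alpha> * norm (w - r)"
    using \<alpha> by (simp add: a'_def md_def flip: scaleR_diff_right)
  then have "G a' \<le> G md + gradG md \<bullet> (a' - md) + L\<^sub>G / 2 * \<alpha>\<^sup>2 * (norm (w - r))\<^sup>2"
    using G_upper[OF Z(2,1)] by (simp add: power_mult_distrib)
  moreover have "G md + gradG md \<bullet> (a' - md) = (1 - \<alpha>) * (G md + gradG md \<bullet> (a - md))
      + \<alpha> * (G md + gradG md \<bullet> (u - md) + gradG md \<bullet> (w - u))"
    by (simp add: a'_def algebra_simps inner_simps)
  moreover have "(1 - \<alpha>) * (G md + gradG md \<bullet> (a - md)) \<le> (1 - \<alpha>) * G a"
    using G_lower[OF in_Z(1) Z(1)] \<alpha> by (intro mult_left_mono) auto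
  moreover have "\<alpha> * (G md + gradG md \<bullet> (u - md) + gradG md \<bullet> (w - u))
      \<le> \<alpha> * (G u + gradG md \<bullet> (w - u))"
    using G_lower[OF in_Z(4) Z(1)] \<alpha> by (intro mult_left_mono) auto
  ultimately have *: "G a' \<le> (1 - \<alpha>) * G a + \<alpha> * (G u + gradG md \<bullet> (w - u))
      + L\<^sub>G / 2 * \<alpha>\<^sup>2 * (norm (w - r))\<^sup>2" by linarith
  have "H u \<bullet> (a' - u) = (1 - \<alpha>) * (H u \<bullet> (a - u)) + \<alpha> * (H u \<bullet> (w - u))"
    by (simp add: a'_def algebra_simps inner_simps)
  moreover have "\<alpha> * (H u \<bullet> (w - u)) \<le> \<alpha> * (H w \<bullet> (w - u))"
    using H_mono[OF in_Z(3,4)] \<alpha> by (intro mult_left_mono) (simp_all add: inner_diff_left)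
  moreover have "J a' \<le> (1 - \<alpha>) * J a + \<alpha> * J w"
    using convex_onD[OF J_convex \<alpha> in_Z(1,3)] by (simp add: a'_def)
  ultimately show ?thesis
    using * unfolding gap_Q_def a'_def[symmetric]
    by (simp add: inner_add_left inner_diff_right algebra_simps)
qed

text \<open>This is the origin of 5 and 3 in the denominator. The number
  \<open>3 * L\<^sub>H * N\<close> is at most \<open>c - 5 * L\<^sub>G\<close> and at most
  \<open>c\<close>, so its square is at most \<open>c * (c - 5 * L\<^sub>G)\<close>; the factor 9
  obtained exceeds the 15/2 that is required.\<close>

lemma step_coefficient:
  fixes t :: real
  assumes "0 \<le> t" "t \<le> N"
  shows "L\<^sub>G * t / (t + 1) + 3 * t\<^sup>2 * L\<^sub>H\<^sup>2 / (2 * c) \<le> c / 5"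
proof -
  have "L\<^sub>G * t / (t + 1) \<le> L\<^sub>G"
    using assms L_nonneg by (simp add: field_simps)
  moreover have "3 * t\<^sup>2 * L\<^sub>H\<^sup>2 / (2 * c) \<le> 3 * (L\<^sub>H * N)\<^sup>2 / (2 * c)"
    using assms c_pos L_nonneg
    by (intro divide_right_mono) (auto simp: power_mult_distrib mult_ac intro!: mult_left_mono power_mono)
  moreover have "3 * (L\<^sub>H * N)\<^sup>2 / (2 * c) \<le> c / 5 - L\<^sub>G"
  proof -
    have nn: "0 \<le> L\<^sub>H * N" using L_nonneg by simp
    have "3 * L\<^sub>H * N * (3 * L\<^sub>H * N) \<le> c * (c - 5 * L\<^sub>G)"
      using c_ge L_nonneg nn c_pos by (intro mult_mono) auto
    then have "9 * (L\<^sub>H * N)\<^sup>2 \<le> c * (c - 5 * L\<^sub>G)"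
      by (simp add: power2_eq_square algebra_simps)
    moreover have "0 \<le> (L\<^sub>H * N)\<^sup>2" by simp
    ultimately have "15 * (L\<^sub>H * N)\<^sup>2 \<le> 2 * c * (c - 5 * L\<^sub>G)" by linarith
    then show ?thesis
      using c_pos by (simp add: field_simps)
  qed
  ultimately show ?thesis by linarith
qed

text \<open>Both prox steps receive the same \<open>g\<close>, so it cancels in the difference of
  their inputs. What remains is \<open>h\<^sub>w - h\<^sub>r\<close>, a Lipschitz part and two
  oracle errors, hence the factor 3. The coefficient 3c/10 is what is left of c/2 after
  \<open>step_coefficient\<close>.\<close>

lemma amp_step:
  fixes t :: nat and a r u h\<^sub>r h\<^sub>w g :: 'a
  assumes in_Z: "a \<in> Z" "r \<in> Z" "u \<in> Z" and t: "1 \<le> t" "t \<le> N"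
  defines "\<alpha> \<equiv> 2 / (real t + 1)" and "\<gamma> \<equiv> real t / c"
  defines "md \<equiv> (1 - \<alpha>) *\<^sub>R a + \<alpha> *\<^sub>R r"
  defines "w \<equiv> prox_mapping Z V J \<gamma> r (\<gamma> *\<^sub>R h\<^sub>r + \<gamma> *\<^sub>R g)"
  defines "r' \<equiv> prox_mapping Z V J \<gamma> r (\<gamma> *\<^sub>R h\<^sub>w + \<gamma> *\<^sub>R g)"
  shows "real t * (real t + 1) / 2 * Q ((1 - \<alpha>) *\<^sub>R a + \<alpha> *\<^sub>R w) u
      + c / 2 * (norm (r' - u))\<^sup>2 + 3 * c / 10 * (norm (w - r))\<^sup>2
    \<le> (real t - 1) * real t / 2 * Q a u + c / 2 * (norm (r - u))\<^sup>2
      + 3 * (real t)\<^sup>2 / (2 * c) * ((norm (h\<^sub>r - H r))\<^sup>2 + (norm (h\<^sub>w - H w))\<^sup>2)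
      - t * ((h\<^sub>w - H w + (g - gradG md)) \<bullet> (w - u))"
proof -
  have \<gamma>: "\<gamma> > 0" and t0: "real t > 0" using t c_pos by (simp_all add: \<gamma>_def)
  have \<alpha>: "0 \<le> \<alpha>" "\<alpha> \<le> 1" using t by (simp_all add: \<alpha>_def)
  have w: "w \<in> Z" using prox_mapping_in[OF in_Z(2) \<gamma>] by (simp add: w_def)
  define x where "x = (norm (w - r))\<^sup>2"
  have "real t * (real t + 1) / 2 * Q ((1 - \<alpha>) *\<^sub>R a + \<alpha> *\<^sub>R w) u
      \<le> real t * (real t + 1) / 2 * ((1 - \<alpha>) * Q a u
    + \<alpha> * ((gradG md + H w) \<bullet> (w - u) + J w - J u) + L\<^sub>G / 2 * \<alpha>\<^sup>2 * x)"
    using gap_Q_averaging[OF in_Z(1,2) w in_Z(3) \<alpha>] by (intro mult_left_mono) (simp_all add: md_def x_def)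
  also have "\<dots> = real t * (real t + 1) / 2 * (1 - \<alpha>) * Q a u
      + real t * (real t + 1) / 2 * \<alpha> * ((gradG md + H w) \<bullet> (w - u) + J w - J u)
      + real t * (real t + 1) / 2 * (L\<^sub>G / 2 * \<alpha>\<^sup>2) * x"
    by (simp only: distrib_left mult.assoc)
  also have "real t * (real t + 1) / 2 * (1 - \<alpha>) = (real t - 1) * real t / 2"
    using t0 by (simp add: \<alpha>_def field_simps)
  also have "real t * (real t + 1) / 2 * (L\<^sub>G / 2 * \<alpha>\<^sup>2)
      = L\<^sub>G / 2 * \<alpha> * (real t * (real t + 1) / 2 * \<alpha>)"
    by (simp add: power2_eq_square)
  also have "real t * (real t + 1) / 2 * \<alpha> = real t"
    using t0 by (simp add: \<alpha>_def field_simps)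
  also have "L\<^sub>G / 2 * \<alpha> * real t = L\<^sub>G * real t / (real t + 1)"
    by (simp add: \<alpha>_def)
  finally have averaging: "real t * (real t + 1) / 2 * Q ((1 - \<alpha>) *\<^sub>R a + \<alpha> *\<^sub>R w) u
      \<le> (real t - 1) * real t / 2 * Q a u + t * ((gradG md + H w) \<bullet> (w - u) + J w - J u)
        + L\<^sub>G * real t / (real t + 1) * x" .

  have "t * ((h\<^sub>w + g) \<bullet> (w - u) + J w - J u)
      = c * ((\<gamma> *\<^sub>R h\<^sub>w + \<gamma> *\<^sub>R g) \<bullet> (w - u) + \<gamma> * (J w - J u))"
    using c_pos by (simp add: \<gamma>_def field_simps inner_simps)
  also have "\<dots> \<le> c * ((norm (r - u))\<^sup>2 / 2 - (norm (r' - u))\<^sup>2 / 2 - x / 2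
      + (norm ((\<gamma> *\<^sub>R h\<^sub>w + \<gamma> *\<^sub>R g) - (\<gamma> *\<^sub>R h\<^sub>r + \<gamma> *\<^sub>R g)))\<^sup>2 / 2)"
    using prox_mapping_extragradient[OF in_Z(2) \<gamma> in_Z(3), of "\<gamma> *\<^sub>R h\<^sub>w + \<gamma> *\<^sub>R g" "\<gamma> *\<^sub>R h\<^sub>r + \<gamma> *\<^sub>R g",
        folded w_def r'_def] c_pos
    by (intro mult_left_mono) (simp_all add: x_def norm_minus_commute[of w r])
  also have "(norm ((\<gamma> *\<^sub>R h\<^sub>w + \<gamma> *\<^sub>R g) - (\<gamma> *\<^sub>R h\<^sub>r + \<gamma> *\<^sub>R g)))\<^sup>2 = \<gamma>\<^sup>2 * (norm (h\<^sub>w - h\<^sub>r))\<^sup>2"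
    by (simp add: power_mult_distrib flip: scaleR_diff_right)
  finally have extragradient: "t * ((h\<^sub>w + g) \<bullet> (w - u) + J w - J u)
      \<le> c / 2 * (norm (r - u))\<^sup>2 - c / 2 * (norm (r' - u))\<^sup>2 - c / 2 * x
        + c * \<gamma>\<^sup>2 / 2 * (norm (h\<^sub>w - h\<^sub>r))\<^sup>2"
    by (simp add: algebra_simps)

  have "(norm (h\<^sub>w - h\<^sub>r))\<^sup>2
      \<le> 3 * ((norm (H w - H r))\<^sup>2 + (norm (h\<^sub>w - H w))\<^sup>2 + (norm (h\<^sub>r - H r))\<^sup>2)"
    using power2_norm_add3_le[of "H w - H r" "h\<^sub>w - H w" "h\<^sub>r - H r"] by simp
  moreover have "(norm (H w - H r))\<^sup>2 \<le> L\<^sub>H\<^sup>2 * x"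
    using power_mono[OF H_lipschitz[OF w in_Z(2)], of 2] by (simp add: x_def power_mult_distrib)
  ultimately have "(norm (h\<^sub>w - h\<^sub>r))\<^sup>2
      \<le> 3 * (L\<^sub>H\<^sup>2 * x + (norm (h\<^sub>r - H r))\<^sup>2 + (norm (h\<^sub>w - H w))\<^sup>2)"
    by argo
  then have "c * \<gamma>\<^sup>2 / 2 * (norm (h\<^sub>w - h\<^sub>r))\<^sup>2
      \<le> c * \<gamma>\<^sup>2 / 2 * (3 * (L\<^sub>H\<^sup>2 * x + (norm (h\<^sub>r - H r))\<^sup>2 + (norm (h\<^sub>w - H w))\<^sup>2))"
    using c_pos by (intro mult_left_mono) simp_all
  also have "\<dots> = 3 * (real t)\<^sup>2 * L\<^sub>H\<^sup>2 / (2 * c) * x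
      + 3 * (real t)\<^sup>2 / (2 * c) * ((norm (h\<^sub>r - H r))\<^sup>2 + (norm (h\<^sub>w - H w))\<^sup>2)"
    using c_pos by (simp add: \<gamma>_def field_simps power2_eq_square)
  finally have noise: "c * \<gamma>\<^sup>2 / 2 * (norm (h\<^sub>w - h\<^sub>r))\<^sup>2 \<le> \<dots>" .

  have "L\<^sub>G * real t / (real t + 1) * x + 3 * (real t)\<^sup>2 * L\<^sub>H\<^sup>2 / (2 * c) * x \<le> c / 5 * x"
    unfolding distrib_right[symmetric]
    using step_coefficient[of t] t by (intro mult_right_mono) (simp_all add: x_def)
  moreover have "t * ((gradG md + H w) \<bullet> (w - u) + J w - J u)
      = t * ((h\<^sub>w + g) \<bullet> (w - u) + J w - J u) - t * ((h\<^sub>w - H w + (g - gradG md)) \<bullet> (w - u))"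
    by (simp add: algebra_simps inner_simps)
  ultimately show ?thesis
    using averaging extragradient noise unfolding x_def[symmetric] by linarith
qed

end

section \<open>Oracle noise at a point independent of the sample\<close>

context prob_space
begin

definition square_integrable :: "('a \<Rightarrow> 'b::euclidean_space) \<Rightarrow> bool" where
  "square_integrable f \<longleftrightarrow> f \<in> borel_measurable M \<and> integrable M (\<lambda>\<omega>. (norm (f \<omega>))\<^sup>2)"

lemma square_integrableD:
  assumes "square_integrable f"
  shows "f \<in> borel_measurable M" "integrable M (\<lambda>\<omega>. (norm (f \<omega>))\<^sup>2)"
  using assms by (simp_all add: square_integrable_def)

lemma integrable_inner_of_square_integrable:
  assumes f: "square_integrable f" and g: "square_integrable g"
  shows "integrable M (\<lambda>\<omega>. f \<omega> \<bullet> g \<omega>)"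
proof (rule Bochner_Integration.integrable_bound)
  note [measurable] = square_integrableD(1)[OF f] square_integrableD(1)[OF g]
  show "(\<lambda>\<omega>. f \<omega> \<bullet> g \<omega>) \<in> borel_measurable M" by measurable
  show "integrable M (\<lambda>\<omega>. (norm (f \<omega>))\<^sup>2 + (norm (g \<omega>))\<^sup>2)"
    using square_integrableD(2)[OF f] square_integrableD(2)[OF g] by simp
  have "\<bar>a \<bullet> b\<bar> \<le> (norm a)\<^sup>2 + (norm b)\<^sup>2" for a b :: 'b
  proof -
    have "\<bar>a \<bullet> b\<bar> \<le> norm a * norm b" by (rule Cauchy_Schwarz_ineq2)
    moreover have "2 * (norm a * norm b) \<le> (norm a)\<^sup>2 + (norm b)\<^sup>2"
      using sum_squares_bound[of "norm a" "norm b"] by simp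
    moreover have "0 \<le> norm a * norm b" by simp
    ultimately show ?thesis by linarith
  qed
  then show "AE \<omega> in M. norm (f \<omega> \<bullet> g \<omega>) \<le> norm ((norm (f \<omega>))\<^sup>2 + (norm (g \<omega>))\<^sup>2)" by simp
qed

lemma square_integrable_const: "square_integrable (\<lambda>_. a)"
  by (simp add: square_integrable_def)

lemma square_integrable_scaleR:
  assumes "square_integrable f"
  shows "square_integrable (\<lambda>\<omega>. k *\<^sub>R f \<omega>)"
  using square_integrableD[OF assms] by (auto simp: square_integrable_def power_mult_distrib)

lemma square_integrable_add:
  assumes f: "square_integrable f" and g: "square_integrable g"
  shows "square_integrable (\<lambda>\<omega>. f \<omega> + g \<omega>)"
proof -
  have "(\<lambda>\<omega>. (norm (f \<omega> + g \<omega>))\<^sup>2) = (\<lambda>\<omega>. (norm (f \<omega>))\<^sup>2 + 2 * (f \<omega> \<bullet> g \<omega>) + (norm (g \<omega>))\<^sup>2)"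
    unfolding power2_norm_eq_inner by (simp add: fun_eq_iff inner_simps inner_commute)
  then show ?thesis
    using square_integrableD[OF f] square_integrableD[OF g] integrable_inner_of_square_integrable[OF f g]
    by (auto simp: square_integrable_def)
qed

lemma square_integrable_diff:
  assumes f: "square_integrable f" and g: "square_integrable g"
  shows "square_integrable (\<lambda>\<omega>. f \<omega> - g \<omega>)"
  using square_integrable_add[OF f square_integrable_scaleR[OF g, of "-1"]] by simp

lemma square_integrable_sum:
  assumes "\<And>i. i \<in> I \<Longrightarrow> square_integrable (f i)"
  shows "square_integrable (\<lambda>\<omega>. \<Sum>i\<in>I. f i \<omega>)"
  using assms
  by (induction I rule: infinite_finite_induct) (auto intro: square_integrable_add square_integrable_const)

lemma integrable_of_square_integrable:
  assumes f: "square_integrable f"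
  shows "integrable M f"
proof (rule Bochner_Integration.integrable_bound)
  show "integrable M (\<lambda>\<omega>. (norm (f \<omega>))\<^sup>2 + 1)" using square_integrableD(2)[OF f] by simp
  have "norm (f \<omega>) \<le> (norm (f \<omega>))\<^sup>2 + 1" for \<omega>
    using sum_squares_bound[of "norm (f \<omega>)" 1] norm_ge_zero[of "f \<omega>"] unfolding power_one by linarith
  then show "AE \<omega> in M. norm (f \<omega>) \<le> norm ((norm (f \<omega>))\<^sup>2 + 1)" by simp
qed (use square_integrableD(1)[OF f] in simp)

lemma square_integrable_of_bound:
  fixes f :: "'a \<Rightarrow> 'b::euclidean_space"
  assumes meas: "f \<in> borel_measurable M" and B: "integrable M B" and k: "k > 0"
    and le: "\<And>\<omega>. \<omega> \<in> space M \<Longrightarrow> k * (norm (f \<omega>))\<^sup>2 \<le> B \<omega>"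
  shows "square_integrable f"
  unfolding square_integrable_def
proof
  show "integrable M (\<lambda>\<omega>. (norm (f \<omega>))\<^sup>2)"
  proof (rule Bochner_Integration.integrable_bound)
    show "integrable M (\<lambda>\<omega>. B \<omega> / k)" using B by simp
    show "AE \<omega> in M. norm ((norm (f \<omega>))\<^sup>2) \<le> norm (B \<omega> / k)"
    proof (rule AE_I2)
      fix \<omega> assume "\<omega> \<in> space M"
      then have "(norm (f \<omega>))\<^sup>2 \<le> B \<omega> / k"
        using le[of \<omega>] k by (simp add: field_simps)
      also have "\<dots> \<le> norm (B \<omega> / k)" by (simp only: real_norm_def abs_ge_self)
      finally show "norm ((norm (f \<omega>))\<^sup>2) \<le> norm (B \<omega> / k)" by simp
    qed
  qed (use meas in measurable)
qed fact

text \<open>Nonnegativity of the variance of the norm.\<close>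

lemma expectation_norm_le_sqrt:
  assumes f: "square_integrable f"
    and b: "expectation (\<lambda>\<omega>. (norm (f \<omega>))\<^sup>2) \<le> b"
  shows "expectation (\<lambda>\<omega>. norm (f \<omega>)) \<le> sqrt b"
proof -
  have i: "integrable M (\<lambda>\<omega>. norm (f \<omega>))"
    using integrable_of_square_integrable[OF f] by simp
  have "(expectation (\<lambda>\<omega>. norm (f \<omega>)))\<^sup>2 \<le> expectation (\<lambda>\<omega>. (norm (f \<omega>))\<^sup>2)"
    using variance_positive[of "\<lambda>\<omega>. norm (f \<omega>)"] variance_eq[OF i square_integrableD(2)[OF f]] by simp
  then show ?thesis
    using b by (intro real_le_rsqrt) linarith
qed

text \<open>Fubini for the product law: the sample is integrated first with the query point frozen,
  and there the oracle is unbiased with variance at most \<open>s\<^sup>2\<close>. A second past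
  quantity \<open>g\<close> travels together with \<open>U\<close>, so that the same argument makes
  the noise orthogonal to it.\<close>

lemma
  fixes Z :: "'b::euclidean_space set" and U g :: "'a \<Rightarrow> 'b" and \<zeta> :: "'a \<Rightarrow> 'y"
    and O\<^sub>F :: "'b \<Rightarrow> 'y \<Rightarrow> 'b" and F :: "'b \<Rightarrow> 'b"
  assumes W: "(\<lambda>\<omega>. (U \<omega>, g \<omega>)) \<in> measurable M (restrict_space borel Z \<Otimes>\<^sub>M borel)"
    and \<zeta>: "\<zeta> \<in> measurable M Y"
    and indep: "distr M (restrict_space borel Z \<Otimes>\<^sub>M borel) (\<lambda>\<omega>. (U \<omega>, g \<omega>)) \<Otimes>\<^sub>M distr M Y \<zeta>
      = distr M ((restrict_space borel Z \<Otimes>\<^sub>M borel) \<Otimes>\<^sub>M Y) (\<lambda>\<omega>. ((U \<omega>, g \<omega>), \<zeta> \<omega>))"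
    and F: "continuous_on Z F"
    and O: "(\<lambda>(x, s). O\<^sub>F x s) \<in> borel_measurable (restrict_space borel Z \<Otimes>\<^sub>M Y)"
    and integrable: "\<And>x. x \<in> Z \<Longrightarrow> integrable M (\<lambda>\<omega>. O\<^sub>F x (\<zeta> \<omega>))"
    and mean: "\<And>x. x \<in> Z \<Longrightarrow> expectation (\<lambda>\<omega>. O\<^sub>F x (\<zeta> \<omega>)) = F x"
    and sq_integrable: "\<And>x. x \<in> Z \<Longrightarrow> integrable M (\<lambda>\<omega>. (norm (O\<^sub>F x (\<zeta> \<omega>) - F x))\<^sup>2)"
    and variance: "\<And>x. x \<in> Z \<Longrightarrow> expectation (\<lambda>\<omega>. (norm (O\<^sub>F x (\<zeta> \<omega>) - F x))\<^sup>2) \<le> s\<^sup>2"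
  shows square_integrable_noise: "square_integrable (\<lambda>\<omega>. O\<^sub>F (U \<omega>) (\<zeta> \<omega>) - F (U \<omega>))"
    and expectation_noise_sq: "expectation (\<lambda>\<omega>. (norm (O\<^sub>F (U \<omega>) (\<zeta> \<omega>) - F (U \<omega>)))\<^sup>2) \<le> s\<^sup>2"
    and expectation_noise_inner: "square_integrable g \<Longrightarrow>
      expectation (\<lambda>\<omega>. (O\<^sub>F (U \<omega>) (\<zeta> \<omega>) - F (U \<omega>)) \<bullet> g \<omega>) = 0"
proof -
  let ?S = "restrict_space borel Z \<Otimes>\<^sub>M borel :: ('b \<times> 'b) measure"
  let ?W = "\<lambda>\<omega>. (U \<omega>, g \<omega>)"
  define noise where "noise x s = O\<^sub>F x s - F x" for x s
  note [measurable] = W \<zeta> and eq = indep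
  interpret S: prob_space "distr M ?S ?W" by (rule prob_space_distr) simp
  interpret Y: prob_space "distr M Y \<zeta>" by (rule prob_space_distr) simp
  interpret SY: pair_prob_space "distr M ?S ?W" "distr M Y \<zeta>" ..
  have F_meas[measurable]: "F \<in> borel_measurable (restrict_space borel Z)"
    by (rule borel_measurable_continuous_on_restrict[OF F])
  have noise_meas: "(\<lambda>p. noise (fst p) (snd p)) \<in> borel_measurable (restrict_space borel Z \<Otimes>\<^sub>M Y)"
    using O unfolding noise_def by (simp add: case_prod_beta')
  have noise_meas'[measurable]: "(\<lambda>p. noise (fst (fst p)) (snd p)) \<in> borel_measurable (?S \<Otimes>\<^sub>M Y)"
    using measurable_compose[OF _ noise_meas, of "\<lambda>p. (fst (fst p), snd p)" "?S \<Otimes>\<^sub>M Y"] by simp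
  have slice[measurable]: "noise x \<in> borel_measurable Y" if "x \<in> Z" for x
    using measurable_compose[OF measurable_Pair1' noise_meas, of x] that
    by (simp add: space_restrict_space)
  have fst_Z: "fst z \<in> Z" if "z \<in> space ?S" for z
    using that by (auto simp: space_pair_measure space_restrict_space)
  have WZ: "(\<lambda>\<omega>. (?W \<omega>, \<zeta> \<omega>)) \<in> measurable M (?S \<Otimes>\<^sub>M Y)" by measurable
  have meas: "(\<lambda>\<omega>. noise (U \<omega>) (\<zeta> \<omega>)) \<in> borel_measurable M"
    using measurable_compose[OF WZ noise_meas'] by simp
  have [measurable]: "g \<in> borel_measurable M"
    using measurable_compose[OF W measurable_snd] by simp

  \<comment> \<open>Nonnegative integrals come first because they presuppose no integrability; their
    finite bound yields the square integrability that Fubini for the inner product needs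
    below.\<close>
  have "(\<integral>\<^sup>+\<omega>. ennreal ((norm (noise (U \<omega>) (\<zeta> \<omega>)))\<^sup>2) \<partial>M)
      = (\<integral>\<^sup>+p. ennreal ((norm (noise (fst (fst p)) (snd p)))\<^sup>2) \<partial>distr M (?S \<Otimes>\<^sub>M Y) (\<lambda>\<omega>. (?W \<omega>, \<zeta> \<omega>)))"
    by (subst nn_integral_distr[OF WZ]) simp_all
  also have "\<dots> = (\<integral>\<^sup>+z. \<integral>\<^sup>+y. ennreal ((norm (noise (fst z) y))\<^sup>2) \<partial>distr M Y \<zeta> \<partial>distr M ?S ?W)"
    unfolding eq[symmetric] by (subst Y.nn_integral_fst[symmetric]) simp_all
  also have "\<dots> \<le> (\<integral>\<^sup>+z. ennreal (s\<^sup>2) \<partial>distr M ?S ?W)"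
  proof (rule nn_integral_mono)
    fix z assume "z \<in> space (distr M ?S ?W)"
    then have z: "fst z \<in> Z" using fst_Z by simp
    have "(\<integral>\<^sup>+y. ennreal ((norm (noise (fst z) y))\<^sup>2) \<partial>distr M Y \<zeta>)
        = (\<integral>\<^sup>+\<omega>. ennreal ((norm (noise (fst z) (\<zeta> \<omega>)))\<^sup>2) \<partial>M)"
      by (rule nn_integral_distr) (use slice[OF z] in simp_all)
    also have "\<dots> = ennreal (expectation (\<lambda>\<omega>. (norm (noise (fst z) (\<zeta> \<omega>)))\<^sup>2))"
      by (rule nn_integral_eq_integral) (use sq_integrable[OF z] in \<open>simp_all add: noise_def\<close>)
    finally show "(\<integral>\<^sup>+y. ennreal ((norm (noise (fst z) y))\<^sup>2) \<partial>distr M Y \<zeta>) \<le> ennreal (s\<^sup>2)"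
      using variance[OF z] by (simp add: noise_def ennreal_leI)
  qed
  also have "\<dots> = ennreal (s\<^sup>2)" using S.emeasure_space_1 by simp
  finally have bound: "(\<integral>\<^sup>+\<omega>. ennreal ((norm (noise (U \<omega>) (\<zeta> \<omega>)))\<^sup>2) \<partial>M) \<le> ennreal (s\<^sup>2)" .
  have sq: "integrable M (\<lambda>\<omega>. (norm (noise (U \<omega>) (\<zeta> \<omega>)))\<^sup>2)"
    using meas bound
    by (intro integrableI_bounded) (auto simp: le_less_trans[OF _ ennreal_less_top])
  have L2: "square_integrable (\<lambda>\<omega>. noise (U \<omega>) (\<zeta> \<omega>))"
    using meas sq by (simp add: square_integrable_def)
  then show "square_integrable (\<lambda>\<omega>. O\<^sub>F (U \<omega>) (\<zeta> \<omega>) - F (U \<omega>))" by (simp add: noise_def)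
  show "expectation (\<lambda>\<omega>. (norm (O\<^sub>F (U \<omega>) (\<zeta> \<omega>) - F (U \<omega>)))\<^sup>2) \<le> s\<^sup>2"
    using bound nn_integral_eq_integral[OF sq] by (simp add: noise_def)

  assume g: "square_integrable g"
  let ?f = "\<lambda>p. noise (fst (fst p)) (snd p) \<bullet> snd (fst p)"
  have f_meas: "?f \<in> borel_measurable (?S \<Otimes>\<^sub>M Y)" by measurable
  have "integrable M (\<lambda>\<omega>. noise (U \<omega>) (\<zeta> \<omega>) \<bullet> g \<omega>)"
    by (rule integrable_inner_of_square_integrable[OF L2 g])
  then have f: "integrable (distr M ?S ?W \<Otimes>\<^sub>M distr M Y \<zeta>) ?f"
    unfolding eq by (subst integrable_distr_eq[OF WZ f_meas]) simp
  have "expectation (\<lambda>\<omega>. noise (U \<omega>) (\<zeta> \<omega>) \<bullet> g \<omega>)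
      = (\<integral>p. ?f p \<partial>distr M (?S \<Otimes>\<^sub>M Y) (\<lambda>\<omega>. (?W \<omega>, \<zeta> \<omega>)))"
    by (subst integral_distr[OF WZ f_meas]) simp
  also have "\<dots> = (\<integral>z. \<integral>y. noise (fst z) y \<bullet> snd z \<partial>distr M Y \<zeta> \<partial>distr M ?S ?W)"
    unfolding eq[symmetric] by (subst SY.integral_fst'[OF f, symmetric]) simp
  also have "\<dots> = (\<integral>z. 0 \<partial>distr M ?S ?W)"
  proof (rule Bochner_Integration.integral_cong[OF refl])
    fix z assume "z \<in> space (distr M ?S ?W)"
    then have z: "fst z \<in> Z" using fst_Z by simp
    have i: "integrable M (\<lambda>\<omega>. noise (fst z) (\<zeta> \<omega>))" and "expectation (\<lambda>\<omega>. noise (fst z) (\<zeta> \<omega>)) = 0"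
      using integrable[OF z] mean[OF z] by (simp_all add: noise_def prob_space)
    have "(\<integral>y. noise (fst z) y \<bullet> snd z \<partial>distr M Y \<zeta>) = expectation (\<lambda>\<omega>. noise (fst z) (\<zeta> \<omega>) \<bullet> snd z)"
      by (rule integral_distr) (use slice[OF z] in simp_all)
    also have "\<dots> = expectation (\<lambda>\<omega>. noise (fst z) (\<zeta> \<omega>)) \<bullet> snd z"
      by (rule integral_inner_left) (use i in simp)
    finally show "(\<integral>y. noise (fst z) y \<bullet> snd z \<partial>distr M Y \<zeta>) = 0"
      using \<open>expectation (\<lambda>\<omega>. noise (fst z) (\<zeta> \<omega>)) = 0\<close> by simp
  qed
  finally show "expectation (\<lambda>\<omega>. (O\<^sub>F (U \<omega>) (\<zeta> \<omega>) - F (U \<omega>)) \<bullet> g \<omega>) = 0"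
    by (simp add: noise_def)
qed

end

section \<open>The information available to the method\<close>

text \<open>The family inside \<open>independent_samples\<close>, named so that the past and a fresh
  sample become disjoint sets of indices in one sum type.\<close>

definition sample_events :: "'w measure \<Rightarrow> 'x measure \<Rightarrow> (nat \<Rightarrow> 'w \<Rightarrow> 'x) \<Rightarrow> 'y measure
    \<Rightarrow> (nat \<Rightarrow> 'w \<Rightarrow> 'y) \<Rightarrow> nat + nat \<Rightarrow> 'w set set" where
  "sample_events M X \<xi> Y \<zeta> = case_sum (\<lambda>i. {\<xi> i -` A \<inter> space M | A. A \<in> sets X})
    (\<lambda>i. {\<zeta> i -` A \<inter> space M | A. A \<in> sets Y})"

text \<open>Two counters are kept because an iteration consumes one sample of \<open>gradG\<close>
  and two of \<open>H\<close>, and \<open>w (t + 1)\<close> becomes known between the latter two.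
  The object is a measure only in type; it serves as a \<sigma>-algebra.\<close>

definition history :: "'w measure \<Rightarrow> 'x measure \<Rightarrow> (nat \<Rightarrow> 'w \<Rightarrow> 'x) \<Rightarrow> 'y measure
    \<Rightarrow> (nat \<Rightarrow> 'w \<Rightarrow> 'y) \<Rightarrow> nat \<Rightarrow> nat \<Rightarrow> 'w measure" where
  "history M X \<xi> Y \<zeta> p q = sigma (space M) (\<Union>k\<in>{1..p} <+> {1..q}. sample_events M X \<xi> Y \<zeta> k)"

lemma sample_events_subset_Pow: "sample_events M X \<xi> Y \<zeta> k \<subseteq> Pow (space M)"
  by (auto simp: sample_events_def split: sum.splits)

lemma space_history [simp]: "space (history M X \<xi> Y \<zeta> p q) = space M"
  using sample_events_subset_Pow[of M X \<xi> Y \<zeta>]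
  unfolding history_def by (intro space_measure_of) blast

lemma sets_history: "sets (history M X \<xi> Y \<zeta> p q)
    = sigma_sets (space M) (\<Union>k\<in>{1..p} <+> {1..q}. sample_events M X \<xi> Y \<zeta> k)"
  using sample_events_subset_Pow[of M X \<xi> Y \<zeta>]
  unfolding history_def by (intro sets_measure_of) blast

lemma measurable_history_mono:
  assumes "f \<in> measurable (history M X \<xi> Y \<zeta> p q) S" "p \<le> p'" "q \<le> q'"
  shows "f \<in> measurable (history M X \<xi> Y \<zeta> p' q') S"
proof -
  have "sets (history M X \<xi> Y \<zeta> p q) \<subseteq> sets (history M X \<xi> Y \<zeta> p' q')"
    unfolding sets_history using assms(2,3) by (intro sigma_sets_mono') fastforce
  then show ?thesis
    using assms(1) unfolding measurable_def by auto
qed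

lemma measurable_history_left:
  assumes "\<And>i. i \<ge> 1 \<Longrightarrow> \<xi> i \<in> measurable M X" "1 \<le> i" "i \<le> p"
  shows "\<xi> i \<in> measurable (history M X \<xi> Y \<zeta> p q) X"
proof (rule measurableI)
  fix A assume "A \<in> sets X"
  then have "\<xi> i -` A \<inter> space M \<in> sample_events M X \<xi> Y \<zeta> (Inl i)"
    by (auto simp: sample_events_def)
  moreover have "Inl i \<in> {1..p} <+> {1..q}" using assms(2,3) by auto
  ultimately show "\<xi> i -` A \<inter> space (history M X \<xi> Y \<zeta> p q) \<in> sets (history M X \<xi> Y \<zeta> p q)"
    unfolding sets_history space_history by (intro sigma_sets.Basic) blast
qed (use measurable_space[OF assms(1)[OF assms(2)]] in simp)

lemma measurable_history_right:
  assumes "\<And>i. i \<ge> 1 \<Longrightarrow> \<zeta> i \<in> measurable M Y" "1 \<le> i" "i \<le> q"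
  shows "\<zeta> i \<in> measurable (history M X \<xi> Y \<zeta> p q) Y"
proof (rule measurableI)
  fix A assume "A \<in> sets Y"
  then have "\<zeta> i -` A \<inter> space M \<in> sample_events M X \<xi> Y \<zeta> (Inr i)"
    by (auto simp: sample_events_def)
  moreover have "Inr i \<in> {1..p} <+> {1..q}" using assms(2,3) by auto
  ultimately show "\<zeta> i -` A \<inter> space (history M X \<xi> Y \<zeta> p q) \<in> sets (history M X \<xi> Y \<zeta> p q)"
    unfolding sets_history space_history by (intro sigma_sets.Basic) blast
qed (use measurable_space[OF assms(1)[OF assms(2)]] in simp)

lemma Int_stable_sample_events: "Int_stable (sample_events M X \<xi> Y \<zeta> k)"
proof (rule Int_stableI)
  fix a b assume ab: "a \<in> sample_events M X \<xi> Y \<zeta> k" "b \<in> sample_events M X \<xi> Y \<zeta> k"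
  show "a \<inter> b \<in> sample_events M X \<xi> Y \<zeta> k"
  proof (cases k)
    case (Inl i)
    then obtain A B where "a = \<xi> i -` A \<inter> space M" "b = \<xi> i -` B \<inter> space M" "A \<in> sets X" "B \<in> sets X"
      using ab by (auto simp: sample_events_def)
    then show ?thesis
      using Inl by (auto simp: sample_events_def intro!: exI[of _ "A \<inter> B"])
  next
    case (Inr i)
    then obtain A B where "a = \<zeta> i -` A \<inter> space M" "b = \<zeta> i -` B \<inter> space M" "A \<in> sets Y" "B \<in> sets Y"
      using ab by (auto simp: sample_events_def)
    then show ?thesis
      using Inr by (auto simp: sample_events_def intro!: exI[of _ "A \<inter> B"])
  qed
qed

section \<open>Independence of the past from a fresh sample\<close>

context prob_space
begin

lemma sets_history_subset:
  assumes "independent_samples M X \<xi> Y \<zeta>"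
  shows "sets (history M X \<xi> Y \<zeta> p q) \<subseteq> events"
proof -
  have \<xi>: "\<xi> i \<in> measurable M X" and \<zeta>: "\<zeta> i \<in> measurable M Y" if "Suc 0 \<le> i" for i
    using assms that by (auto simp: independent_samples_def)
  show ?thesis
    unfolding sets_history
    by (intro sets.sigma_sets_subset)
      (auto simp: sample_events_def intro: measurable_sets[OF \<xi>] measurable_sets[OF \<zeta>])
qed

lemma measurable_from_history:
  assumes "independent_samples M X \<xi> Y \<zeta>" "f \<in> measurable (history M X \<xi> Y \<zeta> p q) S"
  shows "f \<in> measurable M S"
  using sets_history_subset[OF assms(1), of p q] assms(2) unfolding measurable_def by auto

text \<open>Disjoint blocks of independent intersection-stable families generate independent
  \<sigma>-algebras. The two blocks, indexed by \<open>bool\<close>, are the past and the single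
  index \<open>k\<close> outside it.\<close>

lemma indep_set_history:
  assumes samples: "independent_samples M X \<xi> Y \<zeta>"
    and k: "k \<in> {1..} <+> {1..}" "k \<notin> {1..p} <+> {1..q}"
  shows "indep_set (sets (history M X \<xi> Y \<zeta> p q)) (sigma_sets (space M) (sample_events M X \<xi> Y \<zeta> k))"
proof -
  let ?I = "case_bool ({1..p} <+> {1..q}) {k}"
  have "indep_sets (sample_events M X \<xi> Y \<zeta>) ({1..} <+> {1..})"
    using samples by (simp add: independent_samples_def sample_events_def)
  then have "indep_sets (sample_events M X \<xi> Y \<zeta>) (\<Union>b\<in>UNIV. ?I b)"
    by (rule indep_sets_mono_index[rotated]) (use k in \<open>auto simp: UNIV_bool\<close>)
  then have "indep_sets (\<lambda>b. sigma_sets (space M) (\<Union>i\<in>?I b. sample_events M X \<xi> Y \<zeta> i)) UNIV"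
    by (rule indep_sets_collect_sigma)
      (use k in \<open>auto simp: Int_stable_sample_events disjoint_family_on_def split: bool.splits\<close>)
  also have "(\<lambda>b. sigma_sets (space M) (\<Union>i\<in>?I b. sample_events M X \<xi> Y \<zeta> i))
      = case_bool (sets (history M X \<xi> Y \<zeta> p q)) (sigma_sets (space M) (sample_events M X \<xi> Y \<zeta> k))"
    by (auto simp: fun_eq_iff sets_history split: bool.split)
  finally show ?thesis by (simp add: indep_set_def)
qed

text \<open>A product of probability laws is determined by its values on rectangles, and there
  independence is the product rule. In the applications \<open>A\<close> is a history that makes
  \<open>U\<close> measurable.\<close>

lemma distr_pair_of_indep_set:
  assumes U: "U \<in> measurable M S" and \<zeta>: "\<zeta> \<in> measurable M Y"
    and indep: "indep_set A (sigma_sets (space M) {\<zeta> -` B \<inter> space M | B. B \<in> sets Y})"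
    and sub: "\<And>B. B \<in> sets S \<Longrightarrow> U -` B \<inter> space M \<in> A"
  shows "distr M S U \<Otimes>\<^sub>M distr M Y \<zeta> = distr M (S \<Otimes>\<^sub>M Y) (\<lambda>\<omega>. (U \<omega>, \<zeta> \<omega>))"
proof -
  interpret S: prob_space "distr M S U" by (rule prob_space_distr) fact
  interpret Y: prob_space "distr M Y \<zeta>" by (rule prob_space_distr) fact
  have pair: "(\<lambda>\<omega>. (U \<omega>, \<zeta> \<omega>)) \<in> measurable M (S \<Otimes>\<^sub>M Y)"
    using U \<zeta> by measurable
  show ?thesis
  proof (rule pair_measure_eqI)
    show "sigma_finite_measure (distr M S U)" "sigma_finite_measure (distr M Y \<zeta>)" by unfold_locales
  next
    fix B C assume "B \<in> sets (distr M S U)" "C \<in> sets (distr M Y \<zeta>)"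
    then have BC: "B \<in> sets S" "C \<in> sets Y" by simp_all
    then have C: "\<zeta> -` C \<inter> space M \<in> sigma_sets (space M) {\<zeta> -` B \<inter> space M | B. B \<in> sets Y}"
      by (intro sigma_sets.Basic) blast
    have "emeasure (distr M (S \<Otimes>\<^sub>M Y) (\<lambda>\<omega>. (U \<omega>, \<zeta> \<omega>))) (B \<times> C)
        = emeasure M ((\<lambda>\<omega>. (U \<omega>, \<zeta> \<omega>)) -` (B \<times> C) \<inter> space M)"
      using BC by (intro emeasure_distr[OF pair]) auto
    also have "(\<lambda>\<omega>. (U \<omega>, \<zeta> \<omega>)) -` (B \<times> C) \<inter> space M = (U -` B \<inter> space M) \<inter> (\<zeta> -` C \<inter> space M)"
      by auto
    also have "emeasure M \<dots> = emeasure M (U -` B \<inter> space M) * emeasure M (\<zeta> -` C \<inter> space M)"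
      using indep_setD[OF indep sub[OF BC(1)] C]
      by (simp add: emeasure_eq_measure measure_nonneg ennreal_mult)
    also have "\<dots> = emeasure (distr M S U) B * emeasure (distr M Y \<zeta>) C"
      using U \<zeta> BC by (simp add: emeasure_distr)
    finally show "emeasure (distr M S U) B * emeasure (distr M Y \<zeta>) C
        = emeasure (distr M (S \<Otimes>\<^sub>M Y) (\<lambda>\<omega>. (U \<omega>, \<zeta> \<omega>))) (B \<times> C)" ..
  qed simp
qed

lemma
  assumes samples: "independent_samples M X \<xi> Y \<zeta>"
    and U: "U \<in> measurable (history M X \<xi> Y \<zeta> p q) S"
  shows distr_history_left: "p < i \<Longrightarrow>
      distr M S U \<Otimes>\<^sub>M distr M X (\<xi> i) = distr M (S \<Otimes>\<^sub>M X) (\<lambda>\<omega>. (U \<omega>, \<xi> i \<omega>))"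
    and distr_history_right: "q < i \<Longrightarrow>
      distr M S U \<Otimes>\<^sub>M distr M Y (\<zeta> i) = distr M (S \<Otimes>\<^sub>M Y) (\<lambda>\<omega>. (U \<omega>, \<zeta> i \<omega>))"
proof -
  have UM: "U \<in> measurable M S" by (rule measurable_from_history[OF samples U])
  have \<xi>: "\<xi> i \<in> measurable M X" and \<zeta>: "\<zeta> i \<in> measurable M Y" if "1 \<le> i"
    using samples that by (auto simp: independent_samples_def)
  show "distr M S U \<Otimes>\<^sub>M distr M X (\<xi> i) = distr M (S \<Otimes>\<^sub>M X) (\<lambda>\<omega>. (U \<omega>, \<xi> i \<omega>))" if "p < i"
    by (rule distr_pair_of_indep_set[OF UM \<xi> indep_set_history[OF samples, of "Inl i" p q, unfolded sample_events_def, simplified]])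
      (use that measurable_sets[OF U] in auto)
  show "distr M S U \<Otimes>\<^sub>M distr M Y (\<zeta> i) = distr M (S \<Otimes>\<^sub>M Y) (\<lambda>\<omega>. (U \<omega>, \<zeta> i \<omega>))" if "q < i"
    by (rule distr_pair_of_indep_set[OF UM \<zeta> indep_set_history[OF samples, of "Inr i" p q, unfolded sample_events_def, simplified]])
      (use that measurable_sets[OF U] in auto)
qed

end

section \<open>Paths of the method\<close>

lemma borel_measurable_oracle:
  assumes O: "(\<lambda>(x, s). O\<^sub>F x s) \<in> borel_measurable (restrict_space borel Z \<Otimes>\<^sub>M Y)"
    and U: "U \<in> borel_measurable A" "\<And>\<omega>. \<omega> \<in> space A \<Longrightarrow> U \<omega> \<in> Z"
    and \<zeta>: "\<zeta> \<in> measurable A Y"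
  shows "(\<lambda>\<omega>. O\<^sub>F (U \<omega>) (\<zeta> \<omega>)) \<in> borel_measurable A"
proof -
  have "U \<in> measurable A (restrict_space borel Z)"
    using U by (intro measurable_restrict_space2) auto
  then have "(\<lambda>\<omega>. (U \<omega>, \<zeta> \<omega>)) \<in> measurable A (restrict_space borel Z \<Otimes>\<^sub>M Y)"
    using \<zeta> by measurable
  from measurable_compose[OF this O] show ?thesis by simp
qed

locale amp_run = amp_setting Z V J G gradG H L\<^sub>G L\<^sub>H c N + prob_space M
  for Z :: "'a::euclidean_space set" and V J G gradG H L\<^sub>G L\<^sub>H c N and M :: "'w measure" +
  fixes X :: "'x measure" and Y :: "'y measure"
    and \<xi> :: "nat \<Rightarrow> 'w \<Rightarrow> 'x" and \<zeta> :: "nat \<Rightarrow> 'w \<Rightarrow> 'y"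
    and O\<^sub>G :: "'a \<Rightarrow> 'x \<Rightarrow> 'a" and O\<^sub>H :: "'a \<Rightarrow> 'y \<Rightarrow> 'a"
    and \<sigma>\<^sub>G \<sigma>\<^sub>H :: real and \<alpha> \<gamma> :: "nat \<Rightarrow> real" and r1 us :: 'a
    and r w w_md w_ag :: "nat \<Rightarrow> 'w \<Rightarrow> 'a"
  assumes samples: "independent_samples M X \<xi> Y \<zeta>"
    and gradG_cont: "continuous_on Z gradG"
    and oracles: "unbiased_oracle Z M X \<xi> O\<^sub>G gradG" "unbiased_oracle Z M Y \<zeta> O\<^sub>H H"
    and variances: "bounded_variance Z M \<xi> O\<^sub>G gradG \<sigma>\<^sub>G" "bounded_variance Z M \<zeta> O\<^sub>H H \<sigma>\<^sub>H"
    and us: "us \<in> Z" "\<And>u. u \<in> Z \<Longrightarrow> 0 \<le> gap_Q G H J u us"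
    and r1: "r1 \<in> Z"
    and N: "N \<ge> 2"
    and \<alpha>: "\<And>t. t \<in> {1..<N} \<Longrightarrow> \<alpha> t = 2 / (real t + 1)"
    and \<gamma>: "\<And>t. t \<in> {1..<N} \<Longrightarrow> \<gamma> t = real t / c"
    and AMP: "\<And>\<omega>. \<omega> \<in> space M \<Longrightarrow>
        stochastic_AMP Z V J O\<^sub>G O\<^sub>H \<alpha> \<gamma> N r1 (\<lambda>i. \<xi> i \<omega>) (\<lambda>i. \<zeta> i \<omega>)
          (\<lambda>t. r t \<omega>) (\<lambda>t. w t \<omega>) (\<lambda>t. w_md t \<omega>) (\<lambda>t. w_ag t \<omega>)"
begin

abbreviation hist where "hist \<equiv> history M X \<xi> Y \<zeta>"

text \<open>This error stays out of \<open>\<Delta>\<close>: the value of \<open>H\<close> at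
  \<open>r t\<close> only serves to produce \<open>w (t + 1)\<close>, and its error enters the
  energy through its square alone.\<close>

definition \<Delta>\<^sub>r where "\<Delta>\<^sub>r t \<omega> = O\<^sub>H (r t \<omega>) (\<zeta> (2 * t - 1) \<omega>) - H (r t \<omega>)"
definition \<Delta>\<^sub>w where "\<Delta>\<^sub>w t \<omega> = O\<^sub>H (w (t + 1) \<omega>) (\<zeta> (2 * t) \<omega>) - H (w (t + 1) \<omega>)"
definition \<Delta>\<^sub>G where "\<Delta>\<^sub>G t \<omega> = O\<^sub>G (w_md t \<omega>) (\<xi> t \<omega>) - gradG (w_md t \<omega>)"
definition \<Delta> where "\<Delta> t \<omega> = \<Delta>\<^sub>w t \<omega> + \<Delta>\<^sub>G t \<omega>"
definition martingale where "martingale T \<omega> = (\<Sum>t\<in>{1..<T}. real t *\<^sub>R \<Delta> t \<omega>)"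
text \<open>The amount by which one step can raise the energy relative to \<open>v\<close>. The
  comparison point occurs in the last inner product only, hence affinely.\<close>

definition loss where "loss t v \<omega> = 3 * (real t)\<^sup>2 / (2 * c) * ((norm (\<Delta>\<^sub>r t \<omega>))\<^sup>2 + (norm (\<Delta>\<^sub>w t \<omega>))\<^sup>2)
    - 3 * c / 10 * (norm (w (t + 1) \<omega> - r t \<omega>))\<^sup>2 - t * (\<Delta> t \<omega> \<bullet> (w (t + 1) \<omega> - v))"

lemma run_init:
  assumes "\<omega> \<in> space M"
  shows "r 1 \<omega> = r1" "w 1 \<omega> = r1" "w_ag 1 \<omega> = r1"
  using AMP[OF assms] by (simp_all add: stochastic_AMP_def)

lemma run_step:
  assumes "\<omega> \<in> space M" "t \<in> {1..<N}"
  shows "w_md t \<omega> = (1 - 2 / (real t + 1)) *\<^sub>R w_ag t \<omega> + (2 / (real t + 1)) *\<^sub>R r t \<omega>"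
    and "w (t + 1) \<omega> = prox_mapping Z V J (real t / c) (r t \<omega>)
          ((real t / c) *\<^sub>R O\<^sub>H (r t \<omega>) (\<zeta> (2 * t - 1) \<omega>) + (real t / c) *\<^sub>R O\<^sub>G (w_md t \<omega>) (\<xi> t \<omega>))"
    and "r (t + 1) \<omega> = prox_mapping Z V J (real t / c) (r t \<omega>)
          ((real t / c) *\<^sub>R O\<^sub>H (w (t + 1) \<omega>) (\<zeta> (2 * t) \<omega>) + (real t / c) *\<^sub>R O\<^sub>G (w_md t \<omega>) (\<xi> t \<omega>))"
    and "w_ag (t + 1) \<omega> = (1 - 2 / (real t + 1)) *\<^sub>R w_ag t \<omega> + (2 / (real t + 1)) *\<^sub>R w (t + 1) \<omega>"
  using AMP[OF assms(1)] \<alpha>[OF assms(2)] \<gamma>[OF assms(2)] assms(2)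
  unfolding stochastic_AMP_def by metis+

lemma step_weight: "1 \<le> t \<Longrightarrow> 0 \<le> 2 / (real t + 1) \<and> 2 / (real t + 1) \<le> 1"
  by simp

lemma run_in_Z:
  assumes \<omega>: "\<omega> \<in> space M" and "1 \<le> t" "t \<le> N"
  shows "r t \<omega> \<in> Z" "w t \<omega> \<in> Z" "w_ag t \<omega> \<in> Z"
proof -
  have "t \<le> N \<longrightarrow> r t \<omega> \<in> Z \<and> w t \<omega> \<in> Z \<and> w_ag t \<omega> \<in> Z"
    using \<open>1 \<le> t\<close>
  proof (induction t rule: dec_induct)
    case base
    then show ?case using run_init[OF \<omega>] r1 by simp
  next
    case (step t)
    show ?case
    proof
      assume "Suc t \<le> N"
      then have t: "t \<in> {1..<N}" and IH: "r t \<omega> \<in> Z" "w_ag t \<omega> \<in> Z" using step by auto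
      have \<gamma>: "real t / c > 0" using t c_pos by simp
      have w: "w (t + 1) \<omega> \<in> Z"
        using run_step(2)[OF \<omega> t] prox_mapping_in[OF IH(1) \<gamma>] by simp
      moreover have "r (t + 1) \<omega> \<in> Z"
        using run_step(3)[OF \<omega> t] prox_mapping_in[OF IH(1) \<gamma>] by simp
      moreover have "w_ag (t + 1) \<omega> \<in> Z"
        unfolding run_step(4)[OF \<omega> t] using step_weight[of t] t
        by (intro convexD_alt[OF convex_Z IH(2) w]) auto
      ultimately show "r (Suc t) \<omega> \<in> Z \<and> w (Suc t) \<omega> \<in> Z \<and> w_ag (Suc t) \<omega> \<in> Z" by simp
    qed
  qed
  then show "r t \<omega> \<in> Z" "w t \<omega> \<in> Z" "w_ag t \<omega> \<in> Z" using \<open>t \<le> N\<close> by auto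
qed

lemma run_in_Z':
  assumes "\<omega> \<in> space M" "t \<in> {1..<N}"
  shows "r t \<omega> \<in> Z" "w (t + 1) \<omega> \<in> Z" "w_md t \<omega> \<in> Z"
proof -
  show Z: "r t \<omega> \<in> Z" "w (t + 1) \<omega> \<in> Z" using run_in_Z[OF assms(1)] assms(2) by auto
  show "w_md t \<omega> \<in> Z"
    unfolding run_step(1)[OF assms] using step_weight[of t] assms run_in_Z[OF assms(1), of t]
    by (intro convexD_alt[OF convex_Z]) auto
qed

lemma path_step:
  assumes \<omega>: "\<omega> \<in> space M" and t: "t \<in> {1..<N}" and u: "u \<in> Z"
  shows "real t * (real t + 1) / 2 * Q (w_ag (t + 1) \<omega>) u + c / 2 * (norm (r (t + 1) \<omega> - u))\<^sup>2
    \<le> (real t - 1) * real t / 2 * Q (w_ag t \<omega>) u + c / 2 * (norm (r t \<omega> - u))\<^sup>2 + loss t u \<omega>"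
  using amp_step[of "w_ag t \<omega>" "r t \<omega>" u t "O\<^sub>H (r t \<omega>) (\<zeta> (2 * t - 1) \<omega>)"
      "O\<^sub>G (w_md t \<omega>) (\<xi> t \<omega>)" "O\<^sub>H (w (t + 1) \<omega>) (\<zeta> (2 * t) \<omega>)"]
    run_in_Z[OF \<omega>, of t] t u
  unfolding run_step(1)[OF \<omega> t, symmetric] run_step(2)[OF \<omega> t, symmetric]
    run_step(3)[OF \<omega> t, symmetric] run_step(4)[OF \<omega> t, symmetric]
  unfolding loss_def \<Delta>_def \<Delta>\<^sub>r_def \<Delta>\<^sub>w_def \<Delta>\<^sub>G_def by simp

lemma path_bound:
  assumes \<omega>: "\<omega> \<in> space M" and T: "1 \<le> T" "T \<le> N" and u: "u \<in> Z"
  shows "(real T - 1) * real T / 2 * Q (w_ag T \<omega>) u + c / 2 * (norm (r T \<omega> - u))\<^sup>2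
    \<le> c / 2 * (norm (r1 - u))\<^sup>2 + (\<Sum>t\<in>{1..<T}. loss t u \<omega>)"
proof -
  have "T \<le> N \<longrightarrow> ?thesis"
    using T(1)
  proof (induction T rule: dec_induct)
    \<comment> \<open>The weight \<open>(T - 1) * T / 2\<close> vanishes at \<open>T = 1\<close>, so
      the gap at the starting point does not enter.\<close>
    case base
    then show ?case by (simp add: run_init[OF \<omega>, simplified])
  next
    case (step t)
    then show ?case
      using path_step[OF \<omega> _ u, of t] by (auto simp: algebra_simps)
  qed
  then show ?thesis using T by simp
qed

text \<open>For T > 1 the point \<open>w_ag T\<close> is the average of the points
  \<open>w (t + 1)\<close> with weights 2t/(T(T-1)), so this is Jensen's inequality for the squared
  norm, proved along the recursion instead of through the closed form.\<close>

lemma norm_w_ag_le: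
  assumes \<omega>: "\<omega> \<in> space M" and T: "1 \<le> T" "T \<le> N"
  shows "(real T - 1) * real T / 2 * (norm (w_ag T \<omega> - v))\<^sup>2
    \<le> (\<Sum>t\<in>{1..<T}. real t * (norm (w (t + 1) \<omega> - v))\<^sup>2)"
proof -
  have "T \<le> N \<longrightarrow> ?thesis"
    using T(1)
  proof (induction T rule: dec_induct)
    case base
    then show ?case by simp
  next
    case (step t)
    show ?case
    proof
      assume "Suc t \<le> N"
      then have t: "t \<in> {1..<N}" using step by simp
      then have t0: "real t > 0" by simp
      define \<alpha> where "\<alpha> = 2 / (real t + 1)"
      have \<alpha>01: "0 \<le> \<alpha>" "\<alpha> \<le> 1" using step_weight[of t] t by (auto simp: \<alpha>_def)
      define a where "a = w_ag t \<omega> - v"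
      define b where "b = w (t + 1) \<omega> - v"
      have eq: "w_ag (t + 1) \<omega> - v = (1 - \<alpha>) *\<^sub>R a + \<alpha> *\<^sub>R b"
        unfolding run_step(4)[OF \<omega> t] a_def b_def \<alpha>_def[symmetric] by (simp add: algebra_simps)
      have "(norm (w_ag (t + 1) \<omega> - v))\<^sup>2
          = (1 - \<alpha>) * (norm a)\<^sup>2 + \<alpha> * (norm b)\<^sup>2 - \<alpha> * (1 - \<alpha>) * (norm (a - b))\<^sup>2"
        unfolding eq power2_norm_eq_inner by (simp add: algebra_simps inner_simps inner_commute)
      also have "\<dots> \<le> (1 - \<alpha>) * (norm a)\<^sup>2 + \<alpha> * (norm b)\<^sup>2"
        using \<alpha>01 by simp
      finally have "real t * (real t + 1) / 2 * (norm (w_ag (t + 1) \<omega> - v))\<^sup>2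
          \<le> real t * (real t + 1) / 2 * ((1 - \<alpha>) * (norm a)\<^sup>2 + \<alpha> * (norm b)\<^sup>2)"
        by (intro mult_left_mono) simp_all
      also have "\<dots> = real t * (real t + 1) / 2 * (1 - \<alpha>) * (norm a)\<^sup>2
          + real t * (real t + 1) / 2 * \<alpha> * (norm b)\<^sup>2"
        by (simp only: distrib_left mult.assoc)
      also have "real t * (real t + 1) / 2 * (1 - \<alpha>) = (real t - 1) * real t / 2"
        using t0 by (simp add: \<alpha>_def field_simps)
      also have "real t * (real t + 1) / 2 * \<alpha> = real t"
        using t0 by (simp add: \<alpha>_def field_simps)
      finally show "(real (Suc t) - 1) * real (Suc t) / 2 * (norm (w_ag (Suc t) \<omega> - v))\<^sup>2
          \<le> (\<Sum>t\<in>{1..<Suc t}. real t * (norm (w (t + 1) \<omega> - v))\<^sup>2)"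
        using step t by (simp add: a_def b_def add.commute)
    qed
  qed
  then show ?thesis using T by simp
qed

section \<open>Separating the comparison point on a single path\<close>

lemma loss_shift: "loss t u \<omega> = loss t v \<omega> + (real t *\<^sub>R \<Delta> t \<omega>) \<bullet> (u - v)"
  by (simp add: loss_def algebra_simps inner_simps)

text \<open>The losses are shifted to the deterministic point \<open>r1\<close>, so that their noise
  terms stay centred, and the squares are expanded around \<open>w_ag N\<close>. All terms linear in
  \<open>w_ag N - u\<close> go to the left; the right-hand side no longer contains
  \<open>u\<close>.\<close>

lemma path_gap_bound:
  assumes \<omega>: "\<omega> \<in> space M" and u: "u \<in> Z"
  shows "(real N - 1) * real N / 2 * Q (w_ag N \<omega>) u
      - (c *\<^sub>R (r1 - r N \<omega>) - martingale N \<omega>) \<bullet> (w_ag N \<omega> - u)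
    \<le> c / 2 * ((norm (r1 - w_ag N \<omega>))\<^sup>2 - (norm (r N \<omega> - w_ag N \<omega>))\<^sup>2)
      + (\<Sum>t\<in>{1..<N}. loss t r1 \<omega>) + martingale N \<omega> \<bullet> (w_ag N \<omega> - r1)"
proof -
  have "(\<Sum>t\<in>{1..<N}. loss t u \<omega>) = (\<Sum>t\<in>{1..<N}. loss t r1 \<omega>) + martingale N \<omega> \<bullet> (u - r1)"
    unfolding martingale_def inner_sum_left sum.distrib[symmetric] loss_shift[of _ u \<omega> r1] ..
  moreover have "c / 2 * (norm (r1 - u))\<^sup>2 - c / 2 * (norm (r N \<omega> - u))\<^sup>2
      = c / 2 * ((norm (r1 - w_ag N \<omega>))\<^sup>2 - (norm (r N \<omega> - w_ag N \<omega>))\<^sup>2)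
        + (c *\<^sub>R (r1 - r N \<omega>)) \<bullet> (w_ag N \<omega> - u)"
    unfolding power2_norm_eq_inner by (simp add: field_simps inner_simps inner_commute)
  moreover have "martingale N \<omega> \<bullet> (u - r1)
      = martingale N \<omega> \<bullet> (w_ag N \<omega> - r1) - martingale N \<omega> \<bullet> (w_ag N \<omega> - u)"
    by (simp add: inner_diff_right)
  ultimately show ?thesis
    using path_bound[OF \<omega> _ _ u, of N] N
    by (simp add: inner_diff_left)
qed

section \<open>Measurability with respect to the past\<close>

lemma measurable_\<xi>: "1 \<le> i \<Longrightarrow> i \<le> p \<Longrightarrow> \<xi> i \<in> measurable (hist p q) X"
  using samples by (intro measurable_history_left) (auto simp: independent_samples_def)

lemma measurable_\<zeta>: "1 \<le> i \<Longrightarrow> i \<le> q \<Longrightarrow> \<zeta> i \<in> measurable (hist p q) Y"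
  using samples by (intro measurable_history_right) (auto simp: independent_samples_def)

lemma oracle_measurable:
  "(\<lambda>(x, s). O\<^sub>G x s) \<in> borel_measurable (restrict_space borel Z \<Otimes>\<^sub>M X)"
  "(\<lambda>(x, s). O\<^sub>H x s) \<in> borel_measurable (restrict_space borel Z \<Otimes>\<^sub>M Y)"
  using oracles by (simp_all add: unbiased_oracle_def)

text \<open>The counters follow the order of sampling. Iteration \<open>t\<close> starts with
  \<open>t - 1\<close> samples of \<open>gradG\<close> and \<open>2 * t - 2\<close> of
  \<open>H\<close>; \<open>\<xi> t\<close> and \<open>\<zeta> (2 * t - 1)\<close> produce
  \<open>w (t + 1)\<close>, and \<open>\<zeta> (2 * t)\<close> is added for
  \<open>r (t + 1)\<close>.\<close>

lemma measurable_step: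
  assumes t: "t \<in> {1..<N}"
    and r: "r t \<in> borel_measurable (hist (t - 1) (2 * t - 2))"
    and ag: "w_ag t \<in> borel_measurable (hist (t - 1) (2 * t - 2))"
  shows "w_md t \<in> borel_measurable (hist (t - 1) (2 * t - 2))" (is ?md)
    and "w (t + 1) \<in> borel_measurable (hist t (2 * t - 1))" (is ?w)
    and "r (t + 1) \<in> borel_measurable (hist t (2 * t))" (is ?r)
    and "w_ag (t + 1) \<in> borel_measurable (hist t (2 * t - 1))" (is ?ag)
proof -
  have \<gamma>: "real t / c > 0" using t c_pos by simp
  have "(\<lambda>\<omega>. (1 - 2 / (real t + 1)) *\<^sub>R w_ag t \<omega> + (2 / (real t + 1)) *\<^sub>R r t \<omega>)
      \<in> borel_measurable (hist (t - 1) (2 * t - 2))"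
    using r ag by measurable
  then show md: ?md
    by (rule measurable_cong[THEN iffD1, rotated]) (simp add: run_step(1)[OF _ t])
  note mono = measurable_history_mono[where p' = t and S = borel]
  have r': "r t \<in> borel_measurable (hist t q)" and md': "w_md t \<in> borel_measurable (hist t q)"
    and ag': "w_ag t \<in> borel_measurable (hist t q)" if "2 * t - 2 \<le> q" for q
    using that mono[OF r, of q] mono[OF md, of q] mono[OF ag, of q] by auto
  have O\<^sub>G: "(\<lambda>\<omega>. O\<^sub>G (w_md t \<omega>) (\<xi> t \<omega>)) \<in> borel_measurable (hist t q)" if "2 * t - 2 \<le> q" for q
    using that t by (intro borel_measurable_oracle[OF oracle_measurable(1)] md' measurable_\<xi>)
      (auto intro: run_in_Z'[OF _ t])
  have O\<^sub>r: "(\<lambda>\<omega>. O\<^sub>H (r t \<omega>) (\<zeta> (2 * t - 1) \<omega>)) \<in> borel_measurable (hist t (2 * t - 1))"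
    using t by (intro borel_measurable_oracle[OF oracle_measurable(2)] r' measurable_\<zeta>)
      (auto intro: run_in_Z'[OF _ t])
  have "(\<lambda>\<omega>. prox_mapping Z V J (real t / c) (r t \<omega>)
      ((real t / c) *\<^sub>R O\<^sub>H (r t \<omega>) (\<zeta> (2 * t - 1) \<omega>) + (real t / c) *\<^sub>R O\<^sub>G (w_md t \<omega>) (\<xi> t \<omega>)))
      \<in> borel_measurable (hist t (2 * t - 1))"
    using O\<^sub>r O\<^sub>G[of "2 * t - 1"] r'[of "2 * t - 1"]
    by (intro borel_measurable_prox_mapping[OF \<gamma>]) (auto intro: run_in_Z'[OF _ t])
  then show w: ?w
    by (rule measurable_cong[THEN iffD1, rotated]) (simp only: run_step(2)[OF _ t] space_history)
  have w': "w (t + 1) \<in> borel_measurable (hist t (2 * t))"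
    by (rule measurable_history_mono[OF w]) auto
  have O\<^sub>w: "(\<lambda>\<omega>. O\<^sub>H (w (t + 1) \<omega>) (\<zeta> (2 * t) \<omega>)) \<in> borel_measurable (hist t (2 * t))"
    using t by (intro borel_measurable_oracle[OF oracle_measurable(2)] w' measurable_\<zeta>)
      (auto intro: run_in_Z'(2)[OF _ t, simplified])
  have "(\<lambda>\<omega>. prox_mapping Z V J (real t / c) (r t \<omega>)
      ((real t / c) *\<^sub>R O\<^sub>H (w (t + 1) \<omega>) (\<zeta> (2 * t) \<omega>) + (real t / c) *\<^sub>R O\<^sub>G (w_md t \<omega>) (\<xi> t \<omega>)))
      \<in> borel_measurable (hist t (2 * t))"
    using O\<^sub>w O\<^sub>G[of "2 * t"] r'[of "2 * t"]
    by (intro borel_measurable_prox_mapping[OF \<gamma>]) (auto intro: run_in_Z'[OF _ t])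
  then show ?r
    by (rule measurable_cong[THEN iffD1, rotated]) (simp only: run_step(3)[OF _ t] space_history)
  have "(\<lambda>\<omega>. (1 - 2 / (real t + 1)) *\<^sub>R w_ag t \<omega> + (2 / (real t + 1)) *\<^sub>R w (t + 1) \<omega>)
      \<in> borel_measurable (hist t (2 * t - 1))"
    using w ag'[of "2 * t - 1"] by measurable
  then show ?ag
    by (rule measurable_cong[THEN iffD1, rotated]) (simp only: run_step(4)[OF _ t] space_history)
qed

lemma measurable_run:
  assumes "1 \<le> t" "t \<le> N"
  shows "r t \<in> borel_measurable (hist (t - 1) (2 * t - 2))"
    and "w_ag t \<in> borel_measurable (hist (t - 1) (2 * t - 2))"
proof -
  let ?A = "\<lambda>t. hist (t - 1) (2 * t - 2)"
  have "t \<le> N \<longrightarrow> r t \<in> borel_measurable (?A t) \<and> w_ag t \<in> borel_measurable (?A t)"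
    using \<open>1 \<le> t\<close>
  proof (induction t rule: dec_induct)
    case base
    have "r 1 \<in> borel_measurable (?A 1)"
      by (rule measurable_cong[THEN iffD2, of _ _ "\<lambda>_. r1"]) (simp_all only: run_init space_history borel_measurable_const)
    moreover have "w_ag 1 \<in> borel_measurable (?A 1)"
      by (rule measurable_cong[THEN iffD2, of _ _ "\<lambda>_. r1"]) (simp_all only: run_init space_history borel_measurable_const)
    ultimately show ?case by simp
  next
    case (step t)
    show ?case
    proof
      assume "Suc t \<le> N"
      then have t: "t \<in> {1..<N}" and "t \<le> N" using step by auto
      with step.IH have IH: "r t \<in> borel_measurable (?A t)" "w_ag t \<in> borel_measurable (?A t)" by blast+
      have A: "?A (Suc t) = hist t (2 * t)" by simp
      have "w_ag (t + 1) \<in> borel_measurable (hist t (2 * t))"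
        by (rule measurable_history_mono[OF measurable_step(4)[OF t IH]]) simp_all
      then show "r (Suc t) \<in> borel_measurable (?A (Suc t)) \<and> w_ag (Suc t) \<in> borel_measurable (?A (Suc t))"
        using measurable_step(3)[OF t IH] unfolding A unfolding Suc_eq_plus1 by blast
    qed
  qed
  then show "r t \<in> borel_measurable (?A t)" "w_ag t \<in> borel_measurable (?A t)"
    using \<open>t \<le> N\<close> by auto
qed

section \<open>Second moments of the noise and of the iterates\<close>

lemma from_history: "f \<in> borel_measurable (hist p q) \<Longrightarrow> f \<in> borel_measurable M"
  by (rule measurable_from_history[OF samples])

lemma sample_measurable:
  "1 \<le> i \<Longrightarrow> \<xi> i \<in> measurable M X" "1 \<le> i \<Longrightarrow> \<zeta> i \<in> measurable M Y"
  using samples by (auto simp: independent_samples_def)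

lemma H_cont: "continuous_on Z H"
  unfolding continuous_on_iff
proof (intro ballI allI impI)
  fix x and e :: real assume x: "x \<in> Z" and e: "e > 0"
  \<comment> \<open>Adding 1 to the Lipschitz constant avoids a division by zero.\<close>
  have "dist (H y) (H x) < e" if y: "y \<in> Z" "dist y x < e / (L\<^sub>H + 1)" for y
  proof -
    have "dist (H y) (H x) \<le> L\<^sub>H * dist y x"
      using H_lipschitz[OF y(1) x] by (simp add: dist_norm)
    also have "\<dots> \<le> (L\<^sub>H + 1) * dist y x" by (simp add: distrib_right)
    also have "\<dots> < e" using y(2) L_nonneg by (simp add: field_simps)
    finally show ?thesis .
  qed
  then show "\<exists>d>0. \<forall>x'\<in>Z. dist x' x < d \<longrightarrow> dist (H x') (H x) < e"
    using e L_nonneg by (intro exI[of _ "e / (L\<^sub>H + 1)"]) auto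
qed

lemma measurable_pair_history:
  assumes U: "U \<in> borel_measurable (hist p q)" "\<And>\<omega>. \<omega> \<in> space M \<Longrightarrow> U \<omega> \<in> Z"
    and g: "g \<in> borel_measurable (hist p q)"
  shows "(\<lambda>\<omega>. (U \<omega>, g \<omega>)) \<in> measurable (hist p q) (restrict_space borel Z \<Otimes>\<^sub>M borel)"
proof -
  have "U \<in> measurable (hist p q) (restrict_space borel Z)"
    using U by (intro measurable_restrict_space2) auto
  then show ?thesis using g by measurable
qed

lemma
  assumes U: "U \<in> borel_measurable (hist p q)" "\<And>\<omega>. \<omega> \<in> space M \<Longrightarrow> U \<omega> \<in> Z"
    and i: "p < i"
  shows G_noise: "square_integrable (\<lambda>\<omega>. O\<^sub>G (U \<omega>) (\<xi> i \<omega>) - gradG (U \<omega>))"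
      "expectation (\<lambda>\<omega>. (norm (O\<^sub>G (U \<omega>) (\<xi> i \<omega>) - gradG (U \<omega>)))\<^sup>2) \<le> \<sigma>\<^sub>G\<^sup>2"
    and G_noise_inner: "g \<in> borel_measurable (hist p q) \<Longrightarrow> square_integrable g \<Longrightarrow>
      expectation (\<lambda>\<omega>. (O\<^sub>G (U \<omega>) (\<xi> i \<omega>) - gradG (U \<omega>)) \<bullet> g \<omega>) = 0"
proof -
  have i1: "1 \<le> i" using i by simp
  have pair: "(\<lambda>\<omega>. (U \<omega>, g \<omega>)) \<in> measurable (hist p q) (restrict_space borel Z \<Otimes>\<^sub>M borel)"
    if "g \<in> borel_measurable (hist p q)" for g :: "'w \<Rightarrow> 'a"
    using that by (intro measurable_pair_history U) auto
  \<comment> \<open>The first two claims involve no companion variable, so the zero function takes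
    its place in the pair.\<close>
  have zero: "(\<lambda>_. 0 :: 'a) \<in> borel_measurable (hist p q)" by simp
  note indep = measurable_from_history[OF samples pair] distr_history_left[OF samples pair i]
    and sampling = sample_measurable(1)[OF i1] gradG_cont oracle_measurable(1)
  show "square_integrable (\<lambda>\<omega>. O\<^sub>G (U \<omega>) (\<xi> i \<omega>) - gradG (U \<omega>))"
    using oracles(1) variances(1) i1
    by (intro square_integrable_noise[OF indep(1)[OF zero] sampling(1) indep(2)[OF zero] sampling(2,3)])
      (auto simp: unbiased_oracle_def bounded_variance_def)
  show "expectation (\<lambda>\<omega>. (norm (O\<^sub>G (U \<omega>) (\<xi> i \<omega>) - gradG (U \<omega>)))\<^sup>2) \<le> \<sigma>\<^sub>G\<^sup>2"
    using oracles(1) variances(1) i1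
    by (intro expectation_noise_sq[OF indep(1)[OF zero] sampling(1) indep(2)[OF zero] sampling(2,3)])
      (auto simp: unbiased_oracle_def bounded_variance_def)
  show "expectation (\<lambda>\<omega>. (O\<^sub>G (U \<omega>) (\<xi> i \<omega>) - gradG (U \<omega>)) \<bullet> g \<omega>) = 0"
    if g: "g \<in> borel_measurable (hist p q)" "square_integrable g"
    using oracles(1) variances(1) i1
    by (intro expectation_noise_inner[OF indep(1)[OF g(1)] sampling(1) indep(2)[OF g(1)] sampling(2,3) _ _ _ _ g(2)])
      (auto simp: unbiased_oracle_def bounded_variance_def)
qed

lemma
  assumes U: "U \<in> borel_measurable (hist p q)" "\<And>\<omega>. \<omega> \<in> space M \<Longrightarrow> U \<omega> \<in> Z"
    and i: "q < i"
  shows H_noise: "square_integrable (\<lambda>\<omega>. O\<^sub>H (U \<omega>) (\<zeta> i \<omega>) - H (U \<omega>))"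
      "expectation (\<lambda>\<omega>. (norm (O\<^sub>H (U \<omega>) (\<zeta> i \<omega>) - H (U \<omega>)))\<^sup>2) \<le> \<sigma>\<^sub>H\<^sup>2"
    and H_noise_inner: "g \<in> borel_measurable (hist p q) \<Longrightarrow> square_integrable g \<Longrightarrow>
      expectation (\<lambda>\<omega>. (O\<^sub>H (U \<omega>) (\<zeta> i \<omega>) - H (U \<omega>)) \<bullet> g \<omega>) = 0"
proof -
  have i1: "1 \<le> i" using i by simp
  have pair: "(\<lambda>\<omega>. (U \<omega>, g \<omega>)) \<in> measurable (hist p q) (restrict_space borel Z \<Otimes>\<^sub>M borel)"
    if "g \<in> borel_measurable (hist p q)" for g :: "'w \<Rightarrow> 'a"
    using that by (intro measurable_pair_history U) auto
  have zero: "(\<lambda>_. 0 :: 'a) \<in> borel_measurable (hist p q)" by simp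
  note indep = measurable_from_history[OF samples pair] distr_history_right[OF samples pair i]
    and sampling = sample_measurable(2)[OF i1] H_cont oracle_measurable(2)
  show "square_integrable (\<lambda>\<omega>. O\<^sub>H (U \<omega>) (\<zeta> i \<omega>) - H (U \<omega>))"
    using oracles(2) variances(2) i1
    by (intro square_integrable_noise[OF indep(1)[OF zero] sampling(1) indep(2)[OF zero] sampling(2,3)])
      (auto simp: unbiased_oracle_def bounded_variance_def)
  show "expectation (\<lambda>\<omega>. (norm (O\<^sub>H (U \<omega>) (\<zeta> i \<omega>) - H (U \<omega>)))\<^sup>2) \<le> \<sigma>\<^sub>H\<^sup>2"
    using oracles(2) variances(2) i1
    by (intro expectation_noise_sq[OF indep(1)[OF zero] sampling(1) indep(2)[OF zero] sampling(2,3)])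
      (auto simp: unbiased_oracle_def bounded_variance_def)
  show "expectation (\<lambda>\<omega>. (O\<^sub>H (U \<omega>) (\<zeta> i \<omega>) - H (U \<omega>)) \<bullet> g \<omega>) = 0"
    if g: "g \<in> borel_measurable (hist p q)" "square_integrable g"
    using oracles(2) variances(2) i1
    by (intro expectation_noise_inner[OF indep(1)[OF g(1)] sampling(1) indep(2)[OF g(1)] sampling(2,3) _ _ _ _ g(2)])
      (auto simp: unbiased_oracle_def bounded_variance_def)
qed

lemma measurable_at:
  assumes t: "t \<in> {1..<N}"
  shows "r t \<in> borel_measurable (hist (t - 1) (2 * t - 2))"
    and "w_md t \<in> borel_measurable (hist (t - 1) (2 * t - 2))"
    and "w (t + 1) \<in> borel_measurable (hist t (2 * t - 1))"
  using measurable_run[of t] measurable_step[OF t] t by auto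

lemma \<Delta>\<^sub>r:
  assumes t: "t \<in> {1..<N}"
  shows "square_integrable (\<Delta>\<^sub>r t)" "expectation (\<lambda>\<omega>. (norm (\<Delta>\<^sub>r t \<omega>))\<^sup>2) \<le> \<sigma>\<^sub>H\<^sup>2"
  using H_noise[OF measurable_at(1)[OF t] run_in_Z'(1)[OF _ t], of "2 * t - 1"] t
  unfolding \<Delta>\<^sub>r_def[abs_def] by auto

lemma \<Delta>\<^sub>w:
  assumes t: "t \<in> {1..<N}"
  shows "square_integrable (\<Delta>\<^sub>w t)" "expectation (\<lambda>\<omega>. (norm (\<Delta>\<^sub>w t \<omega>))\<^sup>2) \<le> \<sigma>\<^sub>H\<^sup>2"
    and "g \<in> borel_measurable (hist t (2 * t - 1)) \<Longrightarrow> square_integrable g \<Longrightarrow>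
      expectation (\<lambda>\<omega>. \<Delta>\<^sub>w t \<omega> \<bullet> g \<omega>) = 0"
  using H_noise[OF measurable_at(3)[OF t] run_in_Z'(2)[OF _ t], of "2 * t"]
    H_noise_inner[OF measurable_at(3)[OF t] run_in_Z'(2)[OF _ t], of "2 * t"] t
  unfolding \<Delta>\<^sub>w_def[abs_def] by auto

lemma \<Delta>\<^sub>G:
  assumes t: "t \<in> {1..<N}"
  shows "square_integrable (\<Delta>\<^sub>G t)" "expectation (\<lambda>\<omega>. (norm (\<Delta>\<^sub>G t \<omega>))\<^sup>2) \<le> \<sigma>\<^sub>G\<^sup>2"
    and "g \<in> borel_measurable (hist (t - 1) (2 * t - 2)) \<Longrightarrow> square_integrable g \<Longrightarrow>
      expectation (\<lambda>\<omega>. \<Delta>\<^sub>G t \<omega> \<bullet> g \<omega>) = 0"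
  using G_noise[OF measurable_at(2)[OF t] run_in_Z'(3)[OF _ t], of t]
    G_noise_inner[OF measurable_at(2)[OF t] run_in_Z'(3)[OF _ t], of t] t
  unfolding \<Delta>\<^sub>G_def[abs_def] by auto

lemma \<Delta>: "t \<in> {1..<N} \<Longrightarrow> square_integrable (\<Delta> t)"
  unfolding \<Delta>_def[abs_def] by (intro square_integrable_add \<Delta>\<^sub>w \<Delta>\<^sub>G)

text \<open>The oracle value \<open>O\<^sub>G (w_md t)\<close> need not be square integrable, since \<open>gradG\<close> is not controlled in
  directions normal to \<open>Z\<close>, and \<open>J\<close> need not be measurable. So the second moments of the iterates
  are not obtained from the recursion, but from a pathwise energy inequality with an integrable
  upper bound.\<close>

lemma energy_bounded:
  assumes "1 \<le> t" "t \<le> N"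
  shows "\<exists>B. integrable M B \<and> (\<forall>\<omega>\<in>space M.
    (real t - 1) * real t / 2 * Q (w_ag t \<omega>) us + c / 2 * (norm (r t \<omega> - us))\<^sup>2
      + (if t = 1 then 0 else c / 20 * (norm (w t \<omega> - r (t - 1) \<omega>))\<^sup>2) \<le> B \<omega>)"
    (is "?E t")
proof -
  have "t \<le> N \<longrightarrow> ?E t"
    using \<open>1 \<le> t\<close>
  proof (induction t rule: dec_induct)
    case base
    show ?case
      by (intro impI exI[of _ "\<lambda>_. c / 2 * (norm (r1 - us))\<^sup>2"]) (simp add: run_init[simplified])
  next
    case (step t)
    show ?case
    proof
      assume "Suc t \<le> N"
      then have t: "t \<in> {1..<N}" using step by simp
      then obtain B where B: "integrable M B" and B_ge: "\<And>\<omega>. \<omega> \<in> space M \<Longrightarrow>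
          (real t - 1) * real t / 2 * Q (w_ag t \<omega>) us + c / 2 * (norm (r t \<omega> - us))\<^sup>2
          + (if t = 1 then 0 else c / 20 * (norm (w t \<omega> - r (t - 1) \<omega>))\<^sup>2) \<le> B \<omega>"
        using step by auto
      have pos: "0 \<le> (if t = 1 then 0 else c / 20 * (norm (w t \<omega> - r (t - 1) \<omega>))\<^sup>2)" for \<omega>
        using c_pos by simp
      have Q: "0 \<le> (real t - 1) * real t / 2 * Q (w_ag t \<omega>) us" if "\<omega> \<in> space M" for \<omega>
        using us(2)[of "w_ag t \<omega>"] run_in_Z[OF that, of t] t by simp
      have r: "square_integrable (\<lambda>\<omega>. r t \<omega> - us)"
      proof (rule square_integrable_of_bound)
        show "(\<lambda>\<omega>. r t \<omega> - us) \<in> borel_measurable M"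
          using from_history[OF measurable_at(1)[OF t]] by simp
        show "c / 2 * (norm (r t \<omega> - us))\<^sup>2 \<le> B \<omega>" if "\<omega> \<in> space M" for \<omega>
          using B_ge[OF that] pos[of \<omega>] Q[OF that] by linarith
      qed (use B c_pos in auto)
      \<comment> \<open>Young's inequality is applied only to the part of the noise term along
        \<open>w (t + 1) - r t\<close>; with parameter c/2 it spends c/4 of the available 3c/10 and
        leaves c/20. The part along \<open>r t - us\<close> is kept as it is, being integrable by
        the bound just obtained from the induction hypothesis.\<close>
      define B' where "B' \<omega> = B \<omega>
        + 3 * (real t)\<^sup>2 / (2 * c) * ((norm (\<Delta>\<^sub>r t \<omega>))\<^sup>2 + (norm (\<Delta>\<^sub>w t \<omega>))\<^sup>2)
        + (real t)\<^sup>2 * (norm (\<Delta> t \<omega>))\<^sup>2 / (2 * (c / 2)) - t * (\<Delta> t \<omega> \<bullet> (r t \<omega> - us))" for \<omega>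
      have "integrable M B'"
        unfolding B'_def
        using B square_integrableD(2)[OF \<Delta>\<^sub>r(1)[OF t]] square_integrableD(2)[OF \<Delta>\<^sub>w(1)[OF t]]
          square_integrableD(2)[OF \<Delta>[OF t]] integrable_inner_of_square_integrable[OF \<Delta>[OF t] r]
        by auto
      moreover have "real t * (real t + 1) / 2 * Q (w_ag (t + 1) \<omega>) us
          + c / 2 * (norm (r (t + 1) \<omega> - us))\<^sup>2 + c / 20 * (norm (w (t + 1) \<omega> - r t \<omega>))\<^sup>2 \<le> B' \<omega>"
        if \<omega>: "\<omega> \<in> space M" for \<omega>
      proof -
        have "\<Delta> t \<omega> \<bullet> (w (t + 1) \<omega> - us) = \<Delta> t \<omega> \<bullet> (w (t + 1) \<omega> - r t \<omega>) + \<Delta> t \<omega> \<bullet> (r t \<omega> - us)"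
          by (simp add: inner_diff_right)
        then have "real t * (\<Delta> t \<omega> \<bullet> (w (t + 1) \<omega> - us))
            = real t * (\<Delta> t \<omega> \<bullet> (w (t + 1) \<omega> - r t \<omega>)) + real t * (\<Delta> t \<omega> \<bullet> (r t \<omega> - us))"
          by (simp add: distrib_left)
        moreover have "- (real t * (\<Delta> t \<omega> \<bullet> (w (t + 1) \<omega> - r t \<omega>)))
            \<le> (real t)\<^sup>2 * (norm (\<Delta> t \<omega>))\<^sup>2 / (2 * (c / 2)) + c / 2 / 2 * (norm (w (t + 1) \<omega> - r t \<omega>))\<^sup>2"
          using c_pos by (intro neg_inner_le_Young) simp
        ultimately show ?thesis
          using path_step[OF \<omega> t us(1)] B_ge[OF \<omega>] pos[of \<omega>]
          unfolding B'_def loss_def by linarith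
      qed
      ultimately show "?E (Suc t)"
        using t by (intro exI[of _ B']) (simp add: algebra_simps)
    qed
  qed
  then show ?thesis using \<open>t \<le> N\<close> by simp
qed

definition \<sigma>2 where "\<sigma>2 = \<sigma>\<^sub>H\<^sup>2 + \<sigma>\<^sub>G\<^sup>2"
definition R where "R t = expectation (\<lambda>\<omega>. (norm (r t \<omega> - us))\<^sup>2)"
definition W where "W t = expectation (\<lambda>\<omega>. (norm (w (t + 1) \<omega> - r t \<omega>))\<^sup>2)"

lemma W_nonneg: "0 \<le> W t" and R_nonneg: "0 \<le> R t"
  by (simp_all add: W_def R_def)

lemma square_integrable_r_us:
  assumes "1 \<le> t" "t \<le> N"
  shows "square_integrable (\<lambda>\<omega>. r t \<omega> - us)"
proof -
  obtain B where B: "integrable M B" and B_ge: "\<And>\<omega>. \<omega> \<in> space M \<Longrightarrow>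
      (real t - 1) * real t / 2 * Q (w_ag t \<omega>) us + c / 2 * (norm (r t \<omega> - us))\<^sup>2
      + (if t = 1 then 0 else c / 20 * (norm (w t \<omega> - r (t - 1) \<omega>))\<^sup>2) \<le> B \<omega>"
    using energy_bounded[OF assms] by blast
  show ?thesis
  proof (rule square_integrable_of_bound)
    show "(\<lambda>\<omega>. r t \<omega> - us) \<in> borel_measurable M"
      using from_history[OF measurable_run(1)[OF assms]] by simp
    fix \<omega> assume \<omega>: "\<omega> \<in> space M"
    have "0 \<le> (if t = 1 then 0 else c / 20 * (norm (w t \<omega> - r (t - 1) \<omega>))\<^sup>2)"
      using c_pos by simp
    moreover have "0 \<le> (real t - 1) * real t / 2 * Q (w_ag t \<omega>) us"
      using us(2)[of "w_ag t \<omega>"] run_in_Z[OF \<omega> assms] assms by simp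
    ultimately show "c / 2 * (norm (r t \<omega> - us))\<^sup>2 \<le> B \<omega>"
      using B_ge[OF \<omega>] by linarith
  qed (use B c_pos in auto)
qed

lemma square_integrable_step:
  assumes t: "t \<in> {1..<N}"
  shows "square_integrable (\<lambda>\<omega>. w (t + 1) \<omega> - r t \<omega>)"
proof -
  have t': "1 \<le> t + 1" "t + 1 \<le> N" "t + 1 \<noteq> 1" using t by auto
  obtain B where B: "integrable M B" and B_ge: "\<And>\<omega>. \<omega> \<in> space M \<Longrightarrow>
      (real (t + 1) - 1) * real (t + 1) / 2 * Q (w_ag (t + 1) \<omega>) us
      + c / 2 * (norm (r (t + 1) \<omega> - us))\<^sup>2 + c / 20 * (norm (w (t + 1) \<omega> - r t \<omega>))\<^sup>2 \<le> B \<omega>"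
    using energy_bounded[OF t'(1,2)] t'(3) by auto
  show ?thesis
  proof (rule square_integrable_of_bound)
    show "(\<lambda>\<omega>. w (t + 1) \<omega> - r t \<omega>) \<in> borel_measurable M"
      using from_history[OF measurable_at(1)[OF t]] from_history[OF measurable_at(3)[OF t]] by measurable
    fix \<omega> assume \<omega>: "\<omega> \<in> space M"
    have "0 \<le> c / 2 * (norm (r (t + 1) \<omega> - us))\<^sup>2"
      using c_pos by simp
    moreover have "0 \<le> (real (t + 1) - 1) * real (t + 1) / 2 * Q (w_ag (t + 1) \<omega>) us"
      using us(2)[of "w_ag (t + 1) \<omega>"] run_in_Z[OF \<omega> t'(1,2)] by simp
    ultimately show "c / 20 * (norm (w (t + 1) \<omega> - r t \<omega>))\<^sup>2 \<le> B \<omega>"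
      using B_ge[OF \<omega>] by linarith
  qed (use B c_pos in auto)
qed

lemma square_integrable_r: "1 \<le> t \<Longrightarrow> t \<le> N \<Longrightarrow> square_integrable (\<lambda>\<omega>. r t \<omega> - v)"
  using square_integrable_diff[OF square_integrable_r_us square_integrable_const[of "v - us"]]
  by simp

lemma square_integrable_w: "t \<in> {1..<N} \<Longrightarrow> square_integrable (\<lambda>\<omega>. w (t + 1) \<omega> - v)"
  using square_integrable_add[OF square_integrable_step[of t] square_integrable_r[of t v]] by simp

lemma square_integrable_w_ag: "square_integrable (\<lambda>\<omega>. w_ag N \<omega> - v)"
proof (rule square_integrable_of_bound)
  show "(\<lambda>\<omega>. w_ag N \<omega> - v) \<in> borel_measurable M"
    using from_history[OF measurable_run(2)[of N]] N by simp
  show "integrable M (\<lambda>\<omega>. \<Sum>t\<in>{1..<N}. real t * (norm (w (t + 1) \<omega> - v))\<^sup>2)"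
    using square_integrableD(2)[OF square_integrable_w] by (intro Bochner_Integration.integrable_sum) simp
  show "(real N - 1) * real N / 2 * (norm (w_ag N \<omega> - v))\<^sup>2
      \<le> (\<Sum>t\<in>{1..<N}. real t * (norm (w (t + 1) \<omega> - v))\<^sup>2)" if "\<omega> \<in> space M" for \<omega>
    using norm_w_ag_le[OF that] N by simp
  show "0 < (real N - 1) * real N / 2" using N by simp
qed

section \<open>Expected values\<close>

text \<open>The error at \<open>w (t + 1)\<close> is orthogonal to \<open>w (t + 1) - v\<close>, but
  that of \<open>gradG\<close> only to \<open>r t - v\<close>. Its remaining product with the step
  is split by Young's inequality with parameter c/5, which spends c/10 of 3c/10 and leaves the c/5
  in front of \<open>W t\<close>.\<close>

lemma loss:
  assumes t: "t \<in> {1..<N}"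
  shows integrable_loss: "integrable M (loss t v)"
    and expectation_loss: "expectation (loss t v) \<le> 3 * \<sigma>2 * (real t)\<^sup>2 / c - c / 5 * W t"
proof -
  let ?x = "\<lambda>\<omega>. w (t + 1) \<omega> - r t \<omega>" and ?w = "\<lambda>\<omega>. w (t + 1) \<omega> - v" and ?r = "\<lambda>\<omega>. r t \<omega> - v"
  have x: "square_integrable ?x" and w: "square_integrable ?w" and r: "square_integrable ?r"
    using square_integrable_step[OF t] square_integrable_w[OF t] square_integrable_r t by auto
  note sq = square_integrableD(2)[OF \<Delta>\<^sub>r(1)[OF t]] square_integrableD(2)[OF \<Delta>\<^sub>w(1)[OF t]]
    square_integrableD(2)[OF \<Delta>\<^sub>G(1)[OF t]] square_integrableD(2)[OF x]
  note inner = integrable_inner_of_square_integrable[OF \<Delta>\<^sub>w(1)[OF t] w]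
    integrable_inner_of_square_integrable[OF \<Delta>\<^sub>G(1)[OF t] r]
  show loss: "integrable M (loss t v)"
    unfolding loss_def[abs_def]
    using sq integrable_inner_of_square_integrable[OF \<Delta>[OF t] w] by auto
  have "?w \<in> borel_measurable (hist t (2 * t - 1))" "?r \<in> borel_measurable (hist (t - 1) (2 * t - 2))"
    using measurable_at[OF t] by simp_all
  then have zero: "expectation (\<lambda>\<omega>. \<Delta>\<^sub>w t \<omega> \<bullet> ?w \<omega>) = 0" "expectation (\<lambda>\<omega>. \<Delta>\<^sub>G t \<omega> \<bullet> ?r \<omega>) = 0"
    using \<Delta>\<^sub>w(3)[OF t] \<Delta>\<^sub>G(3)[OF t] w r by blast+
  define b where "b \<omega> = 3 * (real t)\<^sup>2 / (2 * c) * ((norm (\<Delta>\<^sub>r t \<omega>))\<^sup>2 + (norm (\<Delta>\<^sub>w t \<omega>))\<^sup>2)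
    + 5 * (real t)\<^sup>2 / (2 * c) * (norm (\<Delta>\<^sub>G t \<omega>))\<^sup>2 - c / 5 * (norm (?x \<omega>))\<^sup>2
    - t * (\<Delta>\<^sub>w t \<omega> \<bullet> ?w \<omega>) - t * (\<Delta>\<^sub>G t \<omega> \<bullet> ?r \<omega>)" for \<omega>
  have b: "integrable M b"
    unfolding b_def[abs_def] using sq inner by auto
  have "expectation (loss t v) \<le> expectation b"
  proof (rule integral_mono[OF loss b])
    fix \<omega>
    have "- (real t * (\<Delta>\<^sub>G t \<omega> \<bullet> ?x \<omega>))
        \<le> (real t)\<^sup>2 * (norm (\<Delta>\<^sub>G t \<omega>))\<^sup>2 / (2 * (c / 5)) + c / 5 / 2 * (norm (?x \<omega>))\<^sup>2"
      using c_pos by (intro neg_inner_le_Young) simp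
    moreover have "(real t)\<^sup>2 * (norm (\<Delta>\<^sub>G t \<omega>))\<^sup>2 / (2 * (c / 5)) = 5 * (real t)\<^sup>2 / (2 * c) * (norm (\<Delta>\<^sub>G t \<omega>))\<^sup>2"
      by simp
    moreover have "real t * (\<Delta> t \<omega> \<bullet> ?w \<omega>)
        = t * (\<Delta>\<^sub>w t \<omega> \<bullet> ?w \<omega>) + t * (\<Delta>\<^sub>G t \<omega> \<bullet> ?r \<omega>) + t * (\<Delta>\<^sub>G t \<omega> \<bullet> ?x \<omega>)"
      by (simp add: \<Delta>_def algebra_simps inner_simps)
    ultimately show "loss t v \<omega> \<le> b \<omega>"
      unfolding loss_def b_def by linarith
  qed
  also have "expectation b = 3 * (real t)\<^sup>2 / (2 * c) * (expectation (\<lambda>\<omega>. (norm (\<Delta>\<^sub>r t \<omega>))\<^sup>2)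
        + expectation (\<lambda>\<omega>. (norm (\<Delta>\<^sub>w t \<omega>))\<^sup>2))
      + 5 * (real t)\<^sup>2 / (2 * c) * expectation (\<lambda>\<omega>. (norm (\<Delta>\<^sub>G t \<omega>))\<^sup>2) - c / 5 * W t"
    unfolding b_def[abs_def] W_def using sq inner zero by simp
  \<comment> \<open>The factor 5 is rounded up to 6 so that both variances carry the same
    coefficient 3 and combine into \<open>\<sigma>2\<close>.\<close>
  also have "\<dots> \<le> 3 * (real t)\<^sup>2 / (2 * c) * (\<sigma>\<^sub>H\<^sup>2 + \<sigma>\<^sub>H\<^sup>2)
      + 6 * (real t)\<^sup>2 / (2 * c) * \<sigma>\<^sub>G\<^sup>2 - c / 5 * W t"
    using \<Delta>\<^sub>r(2)[OF t] \<Delta>\<^sub>w(2)[OF t] \<Delta>\<^sub>G(2)[OF t] c_pos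
    by (intro add_mono diff_mono mult_mono divide_right_mono) (simp_all add: W_nonneg)
  also have "\<dots> = 3 * \<sigma>2 * (real t)\<^sup>2 / c - c / 5 * W t"
    using c_pos by (simp add: \<sigma>2_def field_simps)
  finally show "expectation (loss t v) \<le> 3 * \<sigma>2 * (real t)\<^sup>2 / c - c / 5 * W t" .
qed

lemma \<sigma>2_nonneg: "0 \<le> \<sigma>2"
  by (simp add: \<sigma>2_def)

text \<open>With \<open>us\<close> as comparison point the gap term is nonnegative and is dropped.
  The negative part of the expected losses then controls the squared steps as well as the last
  distance.\<close>

lemma energy_estimate:
  assumes T: "1 \<le> T" "T \<le> N"
  shows "c / 2 * R T + c / 5 * (\<Sum>t\<in>{1..<T}. W t)
    \<le> c / 2 * (norm (r1 - us))\<^sup>2 + 3 * \<sigma>2 / c * (\<Sum>t\<in>{1..<T}. (real t)\<^sup>2)"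
proof -
  note r = square_integrableD(2)[OF square_integrable_r_us[OF T]]
  have l: "integrable M (loss t us)" if "t \<in> {1..<T}" for t
    using that T by (intro integrable_loss) auto
  have L: "integrable M (\<lambda>\<omega>. \<Sum>t\<in>{1..<T}. loss t us \<omega>)"
    by (rule Bochner_Integration.integrable_sum) (rule l)
  have sum_L: "expectation (\<lambda>\<omega>. \<Sum>t\<in>{1..<T}. loss t us \<omega>) = (\<Sum>t\<in>{1..<T}. expectation (loss t us))"
    by (rule Bochner_Integration.integral_sum) (rule l)
  have "expectation (\<lambda>\<omega>. c / 2 * (norm (r T \<omega> - us))\<^sup>2)
      \<le> expectation (\<lambda>\<omega>. c / 2 * (norm (r1 - us))\<^sup>2 + (\<Sum>t\<in>{1..<T}. loss t us \<omega>))"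
  proof (rule integral_mono)
    fix \<omega> assume \<omega>: "\<omega> \<in> space M"
    have "0 \<le> (real T - 1) * real T / 2 * Q (w_ag T \<omega>) us"
      using us(2)[of "w_ag T \<omega>"] run_in_Z[OF \<omega> T] T by simp
    with path_bound[OF \<omega> T us(1)]
    show "c / 2 * (norm (r T \<omega> - us))\<^sup>2 \<le> c / 2 * (norm (r1 - us))\<^sup>2 + (\<Sum>t\<in>{1..<T}. loss t us \<omega>)"
      by linarith
  qed (intro Bochner_Integration.integrable_add integrable_mult_right r L integrable_const)+
  also have "\<dots> = c / 2 * (norm (r1 - us))\<^sup>2 + (\<Sum>t\<in>{1..<T}. expectation (loss t us))"
    unfolding Bochner_Integration.integral_add[OF integrable_const L] sum_L by (simp add: prob_space)
  also have "(\<Sum>t\<in>{1..<T}. expectation (loss t us)) \<le> (\<Sum>t\<in>{1..<T}. 3 * \<sigma>2 * (real t)\<^sup>2 / c - c / 5 * W t)"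
    using T by (intro sum_mono expectation_loss) auto
  also have "\<dots> = 3 * \<sigma>2 / c * (\<Sum>t\<in>{1..<T}. (real t)\<^sup>2) - c / 5 * (\<Sum>t\<in>{1..<T}. W t)"
    by (simp add: sum_subtractf sum_distrib_left)
  finally show ?thesis using r by (simp add: R_def)
qed

lemma R_le:
  assumes T: "1 \<le> T" "T \<le> N"
  shows "R T \<le> (norm (r1 - us))\<^sup>2 + 6 * \<sigma>2 / c\<^sup>2 * (\<Sum>t\<in>{1..<T}. (real t)\<^sup>2)"
proof -
  have "0 \<le> c / 5 * (\<Sum>t\<in>{1..<T}. W t)"
    using c_pos by (simp add: sum_nonneg W_nonneg)
  with energy_estimate[OF T]
  have "c / 2 * R T \<le> c / 2 * (norm (r1 - us))\<^sup>2 + 3 * \<sigma>2 / c * (\<Sum>t\<in>{1..<T}. (real t)\<^sup>2)"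
    by linarith
  also have "\<dots> = c / 2 * ((norm (r1 - us))\<^sup>2 + 6 * \<sigma>2 / c\<^sup>2 * (\<Sum>t\<in>{1..<T}. (real t)\<^sup>2))"
    using c_pos by (simp add: field_simps power2_eq_square)
  finally show ?thesis using c_pos by (metis half_gt_zero mult_le_cancel_left_pos)
qed

text \<open>A single summand is at most the whole sum of nonnegative terms in
  \<open>energy_estimate\<close>, and multiplying by 5/c gives the constants 5/2 and 15.\<close>

lemma W_le:
  assumes t: "t \<in> {1..<N}"
  shows "W t \<le> 5 / 2 * (norm (r1 - us))\<^sup>2 + 15 * \<sigma>2 / c\<^sup>2 * (\<Sum>s\<in>{1..<t + 1}. (real s)\<^sup>2)"
proof -
  have t': "1 \<le> t + 1" "t + 1 \<le> N" using t by auto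
  have "W t \<le> (\<Sum>s\<in>{1..<t + 1}. W s)"
    using t by (intro member_le_sum W_nonneg) auto
  then have "c / 5 * W t \<le> c / 5 * (\<Sum>s\<in>{1..<t + 1}. W s)"
    using c_pos by simp
  moreover have "0 \<le> c / 2 * R (t + 1)" using c_pos R_nonneg by simp
  ultimately have "c / 5 * W t
      \<le> c / 2 * (norm (r1 - us))\<^sup>2 + 3 * \<sigma>2 / c * (\<Sum>s\<in>{1..<t + 1}. (real s)\<^sup>2)"
    using energy_estimate[OF t'] by linarith
  also have "\<dots> = c / 5 * (5 / 2 * (norm (r1 - us))\<^sup>2 + 15 * \<sigma>2 / c\<^sup>2 * (\<Sum>s\<in>{1..<t + 1}. (real s)\<^sup>2))"
    using c_pos by (simp add: field_simps power2_eq_square)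
  finally show ?thesis using c_pos mult_le_cancel_left_pos[of "c / 5"] by simp
qed

text \<open>The path from \<open>w (t + 1)\<close> to \<open>r1\<close> leads through
  \<open>r t\<close> and \<open>us\<close>. The constants are 77/6 = 7/3 * 5/2 + 7/2 + 7/2 and 56 =
  7/3 * 15 + 7/2 * 6.\<close>

lemma expectation_w_r1_le:
  assumes t: "t \<in> {1..<N}"
  shows "expectation (\<lambda>\<omega>. (norm (w (t + 1) \<omega> - r1))\<^sup>2)
    \<le> 77 / 6 * (norm (r1 - us))\<^sup>2 + 56 * \<sigma>2 / c\<^sup>2 * (\<Sum>s\<in>{1..<t + 1}. (real s)\<^sup>2)"
proof -
  let ?D = "(norm (r1 - us))\<^sup>2" and ?S = "\<lambda>T. \<Sum>s\<in>{1..<T}. (real s)\<^sup>2"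
  have t': "1 \<le> t" "t \<le> N" using t by auto
  note sq = square_integrableD(2)[OF square_integrable_step[OF t]]
    square_integrableD(2)[OF square_integrable_r_us[OF t']] square_integrableD(2)[OF square_integrable_w[OF t]]
  have "expectation (\<lambda>\<omega>. (norm (w (t + 1) \<omega> - r1))\<^sup>2) \<le> expectation (\<lambda>\<omega>.
      7/3 * (norm (w (t + 1) \<omega> - r t \<omega>))\<^sup>2 + 7/2 * (norm (r t \<omega> - us))\<^sup>2 + 7/2 * ?D)"
  proof (rule integral_mono)
    fix \<omega>
    show "(norm (w (t + 1) \<omega> - r1))\<^sup>2
        \<le> 7/3 * (norm (w (t + 1) \<omega> - r t \<omega>))\<^sup>2 + 7/2 * (norm (r t \<omega> - us))\<^sup>2 + 7/2 * ?D"
      using norm_add3_sq_le[of "w (t + 1) \<omega> - r t \<omega>" "r t \<omega> - us" "us - r1"]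
      by (simp add: norm_minus_commute[of us r1])
  qed (use sq in auto)
  also have "\<dots> = 7/3 * W t + 7/2 * R t + 7/2 * ?D"
    unfolding W_def R_def using sq by (simp add: prob_space)
  finally have le: "expectation (\<lambda>\<omega>. (norm (w (t + 1) \<omega> - r1))\<^sup>2) \<le> 7/3 * W t + 7/2 * R t + 7/2 * ?D" .
  have "6 * \<sigma>2 / c\<^sup>2 * ?S t \<le> 6 * \<sigma>2 / c\<^sup>2 * ?S (t + 1)"
    using \<sigma>2_nonneg by (intro mult_left_mono sum_mono2) auto
  then have "R t \<le> ?D + 6 * \<sigma>2 / c\<^sup>2 * ?S (t + 1)"
    using R_le[OF t'] by linarith
  moreover have "56 * \<sigma>2 / c\<^sup>2 * ?S (t + 1)
      = 7/3 * (15 * \<sigma>2 / c\<^sup>2 * ?S (t + 1)) + 7/2 * (6 * \<sigma>2 / c\<^sup>2 * ?S (t + 1))"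
    by simp
  ultimately show ?thesis
    using le W_le[OF t] by linarith
qed

lemma expectation_w_ag_le:
  "expectation (\<lambda>\<omega>. (norm (w_ag N \<omega> - r1))\<^sup>2)
    \<le> 77 / 6 * (norm (r1 - us))\<^sup>2 + 28 / 3 * \<sigma>2 / c\<^sup>2 * ((real N - 1) * real N * (real N + 1))"
proof -
  let ?D = "(norm (r1 - us))\<^sup>2" and ?S = "\<lambda>T. \<Sum>s\<in>{1..<T}. (real s)\<^sup>2"
  let ?K = "(real N - 1) * real N / 2"
  have K: "?K > 0" using N by simp
  have "?K * expectation (\<lambda>\<omega>. (norm (w_ag N \<omega> - r1))\<^sup>2) = expectation (\<lambda>\<omega>. ?K * (norm (w_ag N \<omega> - r1))\<^sup>2)"
    by simp
  also have "\<dots> \<le> expectation (\<lambda>\<omega>. \<Sum>t\<in>{1..<N}. real t * (norm (w (t + 1) \<omega> - r1))\<^sup>2)"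
    using square_integrableD(2)[OF square_integrable_w_ag] square_integrableD(2)[OF square_integrable_w] N
    by (intro integral_mono norm_w_ag_le) auto
  also have "\<dots> = (\<Sum>t\<in>{1..<N}. real t * expectation (\<lambda>\<omega>. (norm (w (t + 1) \<omega> - r1))\<^sup>2))"
    using square_integrableD(2)[OF square_integrable_w] by (subst Bochner_Integration.integral_sum) simp_all
  \<comment> \<open>The sum of squares inside depends on \<open>t\<close>, so averaging with weight
    \<open>t\<close> leads to a sum of polynomials of degree four.\<close>
  also have "\<dots> \<le> (\<Sum>t\<in>{1..<N}. real t * (77 / 6 * ?D + 56 * \<sigma>2 / c\<^sup>2 * ?S (t + 1)))"
    by (intro sum_mono mult_left_mono expectation_w_r1_le) auto
  also have "\<dots> = (\<Sum>t\<in>{1..<N}. 77 / 6 * ?D * real t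
      + 56 / 6 * \<sigma>2 / c\<^sup>2 * ((real t)\<^sup>2 * (real t + 1) * (2 * real t + 1)))"
  proof (intro sum.cong refl)
    fix t
    have S: "?S (t + 1) = real t * (real t + 1) * (2 * real t + 1) / 6"
      using sum_squares_upto[of "t + 1"] by (simp add: algebra_simps)
    show "real t * (77 / 6 * ?D + 56 * \<sigma>2 / c\<^sup>2 * ?S (t + 1))
        = 77 / 6 * ?D * real t + 56 / 6 * \<sigma>2 / c\<^sup>2 * ((real t)\<^sup>2 * (real t + 1) * (2 * real t + 1))"
      unfolding S by (simp add: power2_eq_square algebra_simps)
  qed
  also have "\<dots> = 77 / 6 * ?D * (\<Sum>t\<in>{1..<N}. real t)
      + 56 / 6 * \<sigma>2 / c\<^sup>2 * (\<Sum>t\<in>{1..<N}. (real t)\<^sup>2 * (real t + 1) * (2 * real t + 1))"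
    by (simp add: sum.distrib sum_distrib_left)
  also have "(\<Sum>t\<in>{1..<N}. real t) = ?K"
  proof -
    have "1 \<le> T \<Longrightarrow> (\<Sum>t\<in>{1..<T}. real t) = (real T - 1) * real T / 2" for T :: nat
      by (induction T rule: dec_induct) (simp_all add: field_simps)
    then show ?thesis using N by simp
  qed
  also have "56 / 6 * \<sigma>2 / c\<^sup>2 * (\<Sum>t\<in>{1..<N}. (real t)\<^sup>2 * (real t + 1) * (2 * real t + 1))
      \<le> 56 / 6 * \<sigma>2 / c\<^sup>2 * ((real N - 1)\<^sup>2 * (real N)\<^sup>2 * (real N + 1) / 2)"
    using \<sigma>2_nonneg N by (intro mult_left_mono sum_quartic_upto_le) auto
  also have "77 / 6 * ?D * ?K + \<dots>
      = ?K * (77 / 6 * ?D + 28 / 3 * \<sigma>2 / c\<^sup>2 * ((real N - 1) * real N * (real N + 1)))"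
    using c_pos by (simp add: field_simps power2_eq_square)
  finally show ?thesis using K by (simp only: mult_le_cancel_left_pos)
qed

section \<open>The martingale of weighted oracle errors\<close>

lemma measurable_noise:
  assumes t: "t \<in> {1..<N}"
  shows "\<Delta>\<^sub>G t \<in> borel_measurable (hist t (2 * t - 1))" "\<Delta> t \<in> borel_measurable (hist t (2 * t))"
proof -
  have F: "(\<lambda>\<omega>. F (U \<omega>)) \<in> borel_measurable A" if F: "continuous_on Z F"
    and U: "U \<in> borel_measurable A" "\<And>\<omega>. \<omega> \<in> space A \<Longrightarrow> U \<omega> \<in> Z" for F :: "'a \<Rightarrow> 'a" and U and A :: "'w measure"
  proof -
    have "U \<in> measurable A (restrict_space borel Z)"
      using U by (intro measurable_restrict_space2) auto
    then show ?thesis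
      by (rule measurable_compose) (rule borel_measurable_continuous_on_restrict[OF F])
  qed
  have md: "w_md t \<in> borel_measurable (hist t (2 * t - 1))"
    using measurable_at(2)[OF t] by (rule measurable_history_mono) simp_all
  have w: "w (t + 1) \<in> borel_measurable (hist t (2 * t))"
    using measurable_at(3)[OF t] by (rule measurable_history_mono) simp_all
  show G: "\<Delta>\<^sub>G t \<in> borel_measurable (hist t (2 * t - 1))"
    unfolding \<Delta>\<^sub>G_def[abs_def]
  proof (rule borel_measurable_diff)
    show "(\<lambda>\<omega>. O\<^sub>G (w_md t \<omega>) (\<xi> t \<omega>)) \<in> borel_measurable (hist t (2 * t - 1))"
      using t run_in_Z'(3)[OF _ t]
      by (intro borel_measurable_oracle[OF oracle_measurable(1) md] measurable_\<xi>) simp_all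
    show "(\<lambda>\<omega>. gradG (w_md t \<omega>)) \<in> borel_measurable (hist t (2 * t - 1))"
      using run_in_Z'(3)[OF _ t] by (intro F[OF gradG_cont md]) simp_all
  qed
  have "\<Delta>\<^sub>w t \<in> borel_measurable (hist t (2 * t))"
    unfolding \<Delta>\<^sub>w_def[abs_def]
  proof (rule borel_measurable_diff)
    show "(\<lambda>\<omega>. O\<^sub>H (w (t + 1) \<omega>) (\<zeta> (2 * t) \<omega>)) \<in> borel_measurable (hist t (2 * t))"
      using t run_in_Z'(2)[OF _ t]
      by (intro borel_measurable_oracle[OF oracle_measurable(2) w] measurable_\<zeta>) simp_all
    show "(\<lambda>\<omega>. H (w (t + 1) \<omega>)) \<in> borel_measurable (hist t (2 * t))"
      using run_in_Z'(2)[OF _ t] by (intro F[OF H_cont w]) simp_all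
  qed
  moreover have "\<Delta>\<^sub>G t \<in> borel_measurable (hist t (2 * t))"
    using G by (rule measurable_history_mono) simp_all
  ultimately show "\<Delta> t \<in> borel_measurable (hist t (2 * t))"
    unfolding \<Delta>_def[abs_def] by (rule borel_measurable_add)
qed

lemma measurable_martingale:
  assumes "1 \<le> T" "T \<le> N"
  shows "martingale T \<in> borel_measurable (hist (T - 1) (2 * T - 2))"
  unfolding martingale_def[abs_def]
proof (intro borel_measurable_sum borel_measurable_scaleR borel_measurable_const)
  fix t assume t: "t \<in> {1..<T}"
  then have "\<Delta> t \<in> borel_measurable (hist t (2 * t))"
    using assms by (intro measurable_noise) auto
  then show "\<Delta> t \<in> borel_measurable (hist (T - 1) (2 * T - 2))"
    by (rule measurable_history_mono) (use t in auto)
qed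

lemma square_integrable_martingale: "T \<le> N \<Longrightarrow> square_integrable (martingale T)"
  unfolding martingale_def[abs_def]
  by (intro square_integrable_sum square_integrable_scaleR \<Delta>) auto

text \<open>Each increment is added in two halves. The error of \<open>gradG\<close> is orthogonal
  to the previous sum, and the error of \<open>H\<close> is orthogonal to that sum together with the
  new error of \<open>gradG\<close>. All cross terms vanish, so one step costs
  \<open>\<sigma>2\<close> times the squared weight.\<close>

lemma expectation_martingale_sq_le:
  assumes "1 \<le> T" "T \<le> N"
  shows "expectation (\<lambda>\<omega>. (norm (martingale T \<omega>))\<^sup>2) \<le> \<sigma>2 * (\<Sum>t\<in>{1..<T}. (real t)\<^sup>2)"
proof -
  have "T \<le> N \<longrightarrow> ?thesis"
    using \<open>1 \<le> T\<close>
  proof (induction T rule: dec_induct)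
    case base
    then show ?case by (simp add: martingale_def)
  next
    case (step t)
    show ?case
    proof
      assume "Suc t \<le> N"
      then have t: "t \<in> {1..<N}" and t': "1 \<le> t" "t \<le> N" using step by auto
      let ?m = "martingale t" and ?p = "\<lambda>\<omega>. martingale t \<omega> + real t *\<^sub>R \<Delta>\<^sub>G t \<omega>"
      have m: "square_integrable ?m" by (rule square_integrable_martingale[OF t'(2)])
      have p: "square_integrable ?p"
        by (intro square_integrable_add m square_integrable_scaleR \<Delta>\<^sub>G(1)[OF t])
      have m_meas: "?m \<in> borel_measurable (hist (t - 1) (2 * t - 2))"
        by (rule measurable_martingale[OF t'])
      have "?m \<in> borel_measurable (hist t (2 * t - 1))"
        by (rule measurable_history_mono[OF m_meas]) simp_all
      then have p_meas: "?p \<in> borel_measurable (hist t (2 * t - 1))"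
        using measurable_noise(1)[OF t] by measurable
      note sq = square_integrableD(2)[OF m] square_integrableD(2)[OF \<Delta>\<^sub>G(1)[OF t]]
        square_integrableD(2)[OF \<Delta>\<^sub>w(1)[OF t]]
        integrable_inner_of_square_integrable[OF \<Delta>\<^sub>G(1)[OF t] m]
        integrable_inner_of_square_integrable[OF \<Delta>\<^sub>w(1)[OF t] p]
      have split: "(norm (martingale (Suc t) \<omega>))\<^sup>2 = (norm (?m \<omega>))\<^sup>2 + (real t)\<^sup>2 * (norm (\<Delta>\<^sub>G t \<omega>))\<^sup>2
          + (real t)\<^sup>2 * (norm (\<Delta>\<^sub>w t \<omega>))\<^sup>2 + 2 * t * (\<Delta>\<^sub>G t \<omega> \<bullet> ?m \<omega>) + 2 * t * (\<Delta>\<^sub>w t \<omega> \<bullet> ?p \<omega>)" for \<omega>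
      proof -
        have "martingale (Suc t) \<omega> = ?m \<omega> + real t *\<^sub>R (\<Delta>\<^sub>w t \<omega> + \<Delta>\<^sub>G t \<omega>)"
          using t' by (simp add: martingale_def \<Delta>_def)
        then show ?thesis
          unfolding power2_norm_eq_inner
          by (simp add: algebra_simps inner_simps inner_commute power2_eq_square)
      qed
      have "expectation (\<lambda>\<omega>. (norm (martingale (Suc t) \<omega>))\<^sup>2)
          = expectation (\<lambda>\<omega>. (norm (?m \<omega>))\<^sup>2) + (real t)\<^sup>2 * expectation (\<lambda>\<omega>. (norm (\<Delta>\<^sub>G t \<omega>))\<^sup>2)
            + (real t)\<^sup>2 * expectation (\<lambda>\<omega>. (norm (\<Delta>\<^sub>w t \<omega>))\<^sup>2)
            + 2 * t * expectation (\<lambda>\<omega>. \<Delta>\<^sub>G t \<omega> \<bullet> ?m \<omega>) + 2 * t * expectation (\<lambda>\<omega>. \<Delta>\<^sub>w t \<omega> \<bullet> ?p \<omega>)"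
        unfolding split using sq by simp
      also have "\<dots> \<le> \<sigma>2 * (\<Sum>t\<in>{1..<t}. (real t)\<^sup>2) + (real t)\<^sup>2 * \<sigma>\<^sub>G\<^sup>2 + (real t)\<^sup>2 * \<sigma>\<^sub>H\<^sup>2 + 2 * t * 0 + 2 * t * 0"
        unfolding \<Delta>\<^sub>G(3)[OF t m_meas m] \<Delta>\<^sub>w(3)[OF t p_meas p]
        using step.IH t' \<Delta>\<^sub>G(2)[OF t] \<Delta>\<^sub>w(2)[OF t] by (intro add_mono mult_left_mono) auto
      also have "\<dots> = \<sigma>2 * (\<Sum>t\<in>{1..<Suc t}. (real t)\<^sup>2)"
        using t' by (simp add: \<sigma>2_def algebra_simps)
      finally show "expectation (\<lambda>\<omega>. (norm (martingale (Suc t) \<omega>))\<^sup>2) \<le> \<dots>" .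
    qed
  qed
  then show ?thesis using \<open>T \<le> N\<close> by simp
qed

section \<open>The perturbation and the gap\<close>

abbreviation D\<^sub>1 where "D\<^sub>1 \<equiv> norm (r1 - us)"

definition gap_residual where
  "gap_residual \<omega> = c / 2 * ((norm (r1 - w_ag N \<omega>))\<^sup>2 - (norm (r N \<omega> - w_ag N \<omega>))\<^sup>2)
    + (\<Sum>t\<in>{1..<N}. loss t r1 \<omega>) + martingale N \<omega> \<bullet> (w_ag N \<omega> - r1)"

definition v\<^sub>N where "v\<^sub>N \<omega> = (2 / (real N * (real N - 1))) *\<^sub>R (c *\<^sub>R (r1 - r N \<omega>) - martingale N \<omega>)"

definition \<epsilon>\<^sub>N where "\<epsilon>\<^sub>N \<omega> = 2 / (real N * (real N - 1)) * gap_residual \<omega>"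

lemma gap_Q_le_\<epsilon>\<^sub>N:
  assumes \<omega>: "\<omega> \<in> space M" and u: "u \<in> Z"
  shows "Q (w_ag N \<omega>) u - v\<^sub>N \<omega> \<bullet> (w_ag N \<omega> - u) \<le> \<epsilon>\<^sub>N \<omega>"
proof -
  let ?k = "2 / (real N * (real N - 1))"
  have "?k * ((real N - 1) * real N / 2 * Q (w_ag N \<omega>) u
      - (c *\<^sub>R (r1 - r N \<omega>) - martingale N \<omega>) \<bullet> (w_ag N \<omega> - u)) \<le> \<epsilon>\<^sub>N \<omega>"
    unfolding \<epsilon>\<^sub>N_def gap_residual_def using N by (intro mult_left_mono path_gap_bound[OF \<omega> u]) simp
  also have "?k * ((real N - 1) * real N / 2 * Q (w_ag N \<omega>) u
      - (c *\<^sub>R (r1 - r N \<omega>) - martingale N \<omega>) \<bullet> (w_ag N \<omega> - u))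
    = ?k * ((real N - 1) * real N / 2) * Q (w_ag N \<omega>) u - v\<^sub>N \<omega> \<bullet> (w_ag N \<omega> - u)"
    unfolding v\<^sub>N_def inner_scaleR_left by (simp only: right_diff_distrib mult.assoc)
  also have "?k * ((real N - 1) * real N / 2) = 1" using N by simp
  finally show ?thesis by simp
qed

lemma perturbed_gap_le: "\<omega> \<in> space M \<Longrightarrow> perturbed_gap Z G H J (w_ag N \<omega>) (v\<^sub>N \<omega>) \<le> ereal (\<epsilon>\<^sub>N \<omega>)"
  unfolding perturbed_gap_def by (intro SUP_least) (simp add: gap_Q_le_\<epsilon>\<^sub>N)

text \<open>The comparison point \<open>u = w_ag N\<close> makes both the gap and the perturbation
  term zero.\<close>

lemma \<epsilon>\<^sub>N_nonneg: "\<omega> \<in> space M \<Longrightarrow> 0 \<le> \<epsilon>\<^sub>N \<omega>"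
  using gap_Q_le_\<epsilon>\<^sub>N[of \<omega> "w_ag N \<omega>"] run_in_Z(3)[of \<omega> N] N by (simp add: gap_Q_def)

lemma square_integrable_final:
  "square_integrable (\<lambda>\<omega>. r1 - r N \<omega>)" "square_integrable (\<lambda>\<omega>. w_ag N \<omega> - r1)"
  "square_integrable (\<lambda>\<omega>. r N \<omega> - w_ag N \<omega>)" "square_integrable (martingale N)"
proof -
  have r: "square_integrable (\<lambda>\<omega>. r N \<omega> - v)" for v
    using square_integrable_r N by simp
  show "square_integrable (\<lambda>\<omega>. r1 - r N \<omega>)"
    using square_integrable_scaleR[OF r, of "-1" r1] by simp
  show "square_integrable (\<lambda>\<omega>. w_ag N \<omega> - r1)" by (rule square_integrable_w_ag)
  show "square_integrable (\<lambda>\<omega>. r N \<omega> - w_ag N \<omega>)"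
    using square_integrable_diff[OF r square_integrable_w_ag, of r1 r1] by simp
  show "square_integrable (martingale N)" by (rule square_integrable_martingale) simp
qed

lemma integrable_v\<^sub>N: "integrable M v\<^sub>N"
  unfolding v\<^sub>N_def[abs_def]
  by (intro integrable_of_square_integrable square_integrable_scaleR square_integrable_diff square_integrable_final)

lemma
  shows integrable_sum_loss: "integrable M (\<lambda>\<omega>. \<Sum>t\<in>{1..<N}. loss t r1 \<omega>)"
    and expectation_sum_loss: "expectation (\<lambda>\<omega>. \<Sum>t\<in>{1..<N}. loss t r1 \<omega>)
      \<le> 3 * \<sigma>2 / c * (\<Sum>t\<in>{1..<N}. (real t)\<^sup>2)"
proof -
  show "integrable M (\<lambda>\<omega>. \<Sum>t\<in>{1..<N}. loss t r1 \<omega>)"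
    by (rule Bochner_Integration.integrable_sum) (rule integrable_loss)
  have "expectation (\<lambda>\<omega>. \<Sum>t\<in>{1..<N}. loss t r1 \<omega>) = (\<Sum>t\<in>{1..<N}. expectation (loss t r1))"
    by (rule Bochner_Integration.integral_sum) (rule integrable_loss)
  also have "\<dots> \<le> (\<Sum>t\<in>{1..<N}. 3 * \<sigma>2 / c * (real t)\<^sup>2)"
  proof (rule sum_mono)
    fix t assume t: "t \<in> {1..<N}"
    have "0 \<le> c / 5 * W t" using c_pos W_nonneg by simp
    then show "expectation (loss t r1) \<le> 3 * \<sigma>2 / c * (real t)\<^sup>2"
      using expectation_loss[OF t, of r1] by simp
  qed
  finally show "expectation (\<lambda>\<omega>. \<Sum>t\<in>{1..<N}. loss t r1 \<omega>) \<le> 3 * \<sigma>2 / c * (\<Sum>t\<in>{1..<N}. (real t)\<^sup>2)"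
    by (simp add: sum_distrib_left)
qed

text \<open>The negative square is dropped. Young's inequality with parameter c/3 adds c/6 to c/2,
  hence 2c/3; it costs 3/(2c) times the squared martingale, which joins the 6/(2c) coming from the
  losses.\<close>

lemma
  shows integrable_gap_residual: "integrable M gap_residual"
    and expectation_gap_residual: "expectation gap_residual \<le> 2 * c / 3 * expectation (\<lambda>\<omega>. (norm (w_ag N \<omega> - r1))\<^sup>2)
      + 9 / 2 * \<sigma>2 / c * (\<Sum>t\<in>{1..<N}. (real t)\<^sup>2)"
proof -
  let ?S = "\<Sum>t\<in>{1..<N}. (real t)\<^sup>2" and ?m = "martingale N" and ?a = "\<lambda>\<omega>. w_ag N \<omega> - r1"
    and ?L = "\<lambda>\<omega>. \<Sum>t\<in>{1..<N}. loss t r1 \<omega>"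
  note sq = square_integrable_final[THEN square_integrableD(2)]
  note inner = integrable_inner_of_square_integrable[OF square_integrable_final(4,2)]
  have a: "integrable M (\<lambda>\<omega>. (norm (r1 - w_ag N \<omega>))\<^sup>2)"
    using sq(2) by (simp add: norm_minus_commute)
  show int: "integrable M gap_residual"
    unfolding gap_residual_def[abs_def]
    by (intro Bochner_Integration.integrable_add Bochner_Integration.integrable_diff integrable_mult_right
        a sq(3) integrable_sum_loss inner)
  have "expectation gap_residual
      \<le> expectation (\<lambda>\<omega>. 2 * c / 3 * (norm (?a \<omega>))\<^sup>2 + ?L \<omega> + 3 / (2 * c) * (norm (?m \<omega>))\<^sup>2)"
  proof (rule integral_mono[OF int])
    show "integrable M (\<lambda>\<omega>. 2 * c / 3 * (norm (?a \<omega>))\<^sup>2 + ?L \<omega> + 3 / (2 * c) * (norm (?m \<omega>))\<^sup>2)"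
      by (intro Bochner_Integration.integrable_add integrable_mult_right sq(2,4) integrable_sum_loss)
    fix \<omega>
    have "?m \<omega> \<bullet> ?a \<omega> \<le> (norm (?m \<omega>))\<^sup>2 / (2 * (c / 3)) + c / 3 / 2 * (norm (?a \<omega>))\<^sup>2"
      using c_pos by (intro inner_le_Young) simp
    moreover have "(norm (?m \<omega>))\<^sup>2 / (2 * (c / 3)) = 3 / (2 * c) * (norm (?m \<omega>))\<^sup>2" by simp
    moreover have "c / 2 * ((norm (r1 - w_ag N \<omega>))\<^sup>2 - (norm (r N \<omega> - w_ag N \<omega>))\<^sup>2)
        \<le> c / 2 * (norm (?a \<omega>))\<^sup>2"
      using c_pos by (intro mult_left_mono) (simp_all add: norm_minus_commute)
    ultimately show "gap_residual \<omega> \<le> 2 * c / 3 * (norm (?a \<omega>))\<^sup>2 + ?L \<omega> + 3 / (2 * c) * (norm (?m \<omega>))\<^sup>2"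
      unfolding gap_residual_def by linarith
  qed
  also have "\<dots> = 2 * c / 3 * expectation (\<lambda>\<omega>. (norm (?a \<omega>))\<^sup>2) + expectation ?L
      + 3 / (2 * c) * expectation (\<lambda>\<omega>. (norm (?m \<omega>))\<^sup>2)"
    using sq(2,4) integrable_sum_loss by (subst Bochner_Integration.integral_add | simp)+
  also have "\<dots> \<le> 2 * c / 3 * expectation (\<lambda>\<omega>. (norm (?a \<omega>))\<^sup>2) + 3 * \<sigma>2 / c * ?S
      + 3 / (2 * c) * (\<sigma>2 * ?S)"
    using expectation_martingale_sq_le[of N] expectation_sum_loss N c_pos
    by (intro add_mono mult_left_mono order_refl) auto
  also have "3 * \<sigma>2 / c * ?S = 6 / (2 * c) * (\<sigma>2 * ?S)" by simp
  also have "2 * c / 3 * expectation (\<lambda>\<omega>. (norm (?a \<omega>))\<^sup>2) + 6 / (2 * c) * (\<sigma>2 * ?S) + 3 / (2 * c) * (\<sigma>2 * ?S)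
      = 2 * c / 3 * expectation (\<lambda>\<omega>. (norm (?a \<omega>))\<^sup>2) + 9 / 2 * \<sigma>2 / c * ?S"
    using c_pos by (simp add: field_simps)
  finally show "expectation gap_residual \<le> 2 * c / 3 * expectation (\<lambda>\<omega>. (norm (?a \<omega>))\<^sup>2) + 9 / 2 * \<sigma>2 / c * ?S" .
qed

section \<open>Rates in terms of the abstract denominator\<close>

lemma sum_squares_N_le: "(\<Sum>t\<in>{1..<N}. (real t)\<^sup>2) \<le> (real N)\<^sup>2 * (real N - 1) / 3"
proof -
  have "(\<Sum>t\<in>{1..<N}. (real t)\<^sup>2) = (real N - 1) * real N * (2 * real N - 1) / 6"
    using sum_squares_upto[of N] N by simp
  also have "\<dots> \<le> (real N - 1) * real N * (2 * real N) / 6"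
    using N by (intro divide_right_mono mult_left_mono) auto
  also have "\<dots> = (real N)\<^sup>2 * (real N - 1) / 3"
    by (simp add: power2_eq_square)
  finally show ?thesis .
qed

lemma expectation_norm_v\<^sub>N_le:
  "expectation (\<lambda>\<omega>. norm (v\<^sub>N \<omega>))
    \<le> 2 / (real N * (real N - 1)) * (2 * c * D\<^sub>1 + 5 / 2 * (sqrt \<sigma>2 * real N * sqrt (real N - 1)))"
proof -
  let ?S = "\<Sum>t\<in>{1..<N}. (real t)\<^sup>2" and ?s = "sqrt \<sigma>2 * real N * sqrt (real N - 1)"
  have N1: "1 \<le> N" using N by simp
  have s_nonneg: "0 \<le> ?s" using \<sigma>2_nonneg N by simp
  have s: "\<sigma>2 * ?S \<le> ?s\<^sup>2 / 3"
  proof -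
    have "\<sigma>2 * ?S \<le> \<sigma>2 * ((real N)\<^sup>2 * (real N - 1) / 3)"
      using sum_squares_N_le \<sigma>2_nonneg by (rule mult_left_mono)
    then show ?thesis
      using \<sigma>2_nonneg N by (simp add: power_mult_distrib)
  qed
  have "6 * \<sigma>2 / c\<^sup>2 * ?S = 6 / c\<^sup>2 * (\<sigma>2 * ?S)" by simp
  also have "\<dots> \<le> 6 / c\<^sup>2 * (?s\<^sup>2 / 3)" using s by (intro mult_left_mono) auto
  also have "\<dots> = 2 * (?s / c)\<^sup>2" by (simp add: power_divide)
  finally have "R N \<le> D\<^sub>1\<^sup>2 + 2 * (?s / c)\<^sup>2"
    using R_le[OF N1 order_refl] by linarith
  \<comment> \<open>The number 3/2 is a convenient one whose square is at least 2; it makes the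
    bound a perfect square, so that its root is explicit. Together with 1 from the martingale it
    gives the 5/2 of the claim.\<close>
  also have "\<dots> \<le> (D\<^sub>1 + 3 / 2 * (?s / c))\<^sup>2"
  proof -
    have square: "(D\<^sub>1 + 3 / 2 * x)\<^sup>2 = D\<^sub>1\<^sup>2 + 2 * x\<^sup>2 + (3 * D\<^sub>1 * x + x\<^sup>2 / 4)" for x
      by (simp add: power2_eq_square field_simps)
    have "0 \<le> 3 * D\<^sub>1 * (?s / c) + (?s / c)\<^sup>2 / 4" using s_nonneg c_pos by simp
    then show ?thesis unfolding square by linarith
  qed
  finally have "expectation (\<lambda>\<omega>. norm (r N \<omega> - us)) \<le> sqrt ((D\<^sub>1 + 3 / 2 * (?s / c))\<^sup>2)"
    unfolding R_def by (intro expectation_norm_le_sqrt square_integrable_r_us N1 order_refl)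
  also have "\<dots> = D\<^sub>1 + 3 / 2 * (?s / c)"
    using s_nonneg c_pos by (intro real_sqrt_unique) simp_all
  finally have r: "expectation (\<lambda>\<omega>. norm (r N \<omega> - us)) \<le> D\<^sub>1 + 3 / 2 * (?s / c)" .
  have "expectation (\<lambda>\<omega>. (norm (martingale N \<omega>))\<^sup>2) \<le> \<sigma>2 * ?S"
    by (rule expectation_martingale_sq_le[OF N1 order_refl])
  also have "\<dots> \<le> ?s\<^sup>2" using s zero_le_power2[of ?s] by linarith
  finally have "expectation (\<lambda>\<omega>. norm (martingale N \<omega>)) \<le> sqrt (?s\<^sup>2)"
    by (intro expectation_norm_le_sqrt square_integrable_final)
  also have "\<dots> = ?s" using s_nonneg by (rule real_sqrt_unique[OF refl])
  finally have m: "expectation (\<lambda>\<omega>. norm (martingale N \<omega>)) \<le> ?s" .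

  have r_int: "integrable M (\<lambda>\<omega>. norm (r N \<omega> - us))" and m_int: "integrable M (\<lambda>\<omega>. norm (martingale N \<omega>))"
    using integrable_of_square_integrable[OF square_integrable_r_us[OF N1 order_refl]]
      integrable_of_square_integrable[OF square_integrable_final(4)] by simp_all
  let ?k = "2 / (real N * (real N - 1))"
  have k: "0 \<le> ?k" using N by simp
  have "expectation (\<lambda>\<omega>. norm (v\<^sub>N \<omega>))
      \<le> expectation (\<lambda>\<omega>. ?k * (c * D\<^sub>1 + c * norm (r N \<omega> - us) + norm (martingale N \<omega>)))"
  proof (rule integral_mono)
    fix \<omega>
    have "norm (c *\<^sub>R (r1 - r N \<omega>) - martingale N \<omega>) \<le> c * norm (r1 - r N \<omega>) + norm (martingale N \<omega>)"
      using norm_triangle_ineq4[of "c *\<^sub>R (r1 - r N \<omega>)" "martingale N \<omega>"] c_pos by simp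
    also have "c * norm (r1 - r N \<omega>) \<le> c * (D\<^sub>1 + norm (r N \<omega> - us))"
      using norm_triangle_ineq4[of "r1 - us" "r N \<omega> - us"] c_pos by (intro mult_left_mono) simp_all
    finally have "norm (c *\<^sub>R (r1 - r N \<omega>) - martingale N \<omega>)
        \<le> c * D\<^sub>1 + c * norm (r N \<omega> - us) + norm (martingale N \<omega>)"
      by (simp add: distrib_left)
    then show "norm (v\<^sub>N \<omega>) \<le> ?k * (c * D\<^sub>1 + c * norm (r N \<omega> - us) + norm (martingale N \<omega>))"
      using k unfolding v\<^sub>N_def norm_scaleR abs_of_nonneg[OF k] by (intro mult_left_mono) 
  qed (use integrable_v\<^sub>N r_int m_int in auto)
  also have "\<dots> = ?k * (c * D\<^sub>1 + c * expectation (\<lambda>\<omega>. norm (r N \<omega> - us)) + expectation (\<lambda>\<omega>. norm (martingale N \<omega>)))"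
    using r_int m_int by (simp add: prob_space)
  also have "\<dots> \<le> ?k * (c * D\<^sub>1 + c * (D\<^sub>1 + 3 / 2 * (?s / c)) + ?s)"
    using r m k c_pos by (intro mult_left_mono add_mono order_refl) simp_all
  also have "c * D\<^sub>1 + c * (D\<^sub>1 + 3 / 2 * (?s / c)) + ?s = 2 * c * D\<^sub>1 + 5 / 2 * ?s"
    using c_pos by (simp add: distrib_left)
  finally show ?thesis .
qed

lemma expectation_\<epsilon>\<^sub>N_le:
  "expectation \<epsilon>\<^sub>N \<le> 2 / (real N * (real N - 1))
    * (9 * c * D\<^sub>1\<^sup>2 + (19 / 2 + 9 / real N) * (\<sigma>2 * (real N)\<^sup>2 * (real N - 1) / c))"
proof -
  let ?S = "\<Sum>t\<in>{1..<N}. (real t)\<^sup>2" and ?s = "\<sigma>2 * (real N)\<^sup>2 * (real N - 1) / c"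
  have N0: "real N > 0" "real N - 1 > 0" using N by auto
  have s_nonneg: "0 \<le> ?s" using \<sigma>2_nonneg N0 c_pos by simp
  have "expectation gap_residual \<le> 2 * c / 3 * expectation (\<lambda>\<omega>. (norm (w_ag N \<omega> - r1))\<^sup>2)
      + 9 / 2 * \<sigma>2 / c * ?S"
    by (rule expectation_gap_residual)
  also have "\<dots> \<le> 2 * c / 3 * (77 / 6 * D\<^sub>1\<^sup>2 + 28 / 3 * \<sigma>2 / c\<^sup>2 * ((real N - 1) * real N * (real N + 1)))
      + 9 / 2 * \<sigma>2 / c * ((real N)\<^sup>2 * (real N - 1) / 3)"
    using c_pos \<sigma>2_nonneg
    by (intro add_mono mult_left_mono expectation_w_ag_le sum_squares_N_le) simp_all
  also have "2 * c / 3 * (77 / 6 * D\<^sub>1\<^sup>2 + 28 / 3 * \<sigma>2 / c\<^sup>2 * ((real N - 1) * real N * (real N + 1)))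
      = 77 / 9 * c * D\<^sub>1\<^sup>2 + 56 / 9 * (1 + 1 / real N) * ?s"
    using c_pos N0 by (simp add: field_simps power2_eq_square)
  also have "9 / 2 * \<sigma>2 / c * ((real N)\<^sup>2 * (real N - 1) / 3) = 3 / 2 * ?s"
    by simp
  \<comment> \<open>Rounding to the target constants: 77/9 is at most 9, 56/9 + 3/2 is at most 19/2,
    and 56/9 is at most 9 in front of 1/N.\<close>
  also have "77 / 9 * c * D\<^sub>1\<^sup>2 + 56 / 9 * (1 + 1 / real N) * ?s + 3 / 2 * ?s
      \<le> 9 * c * D\<^sub>1\<^sup>2 + (19 / 2 + 9 / real N) * ?s"
  proof -
    have "(56 / 9 * (1 + 1 / real N) + 3 / 2) * ?s \<le> (19 / 2 + 9 / real N) * ?s"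
      using s_nonneg N0 by (intro mult_right_mono) (simp_all add: field_simps)
    moreover have "77 / 9 * c * D\<^sub>1\<^sup>2 \<le> 9 * c * D\<^sub>1\<^sup>2"
      using c_pos by (intro mult_right_mono) simp_all
    ultimately show ?thesis by (simp only: distrib_right) 
  qed
  finally have "2 / (real N * (real N - 1)) * expectation gap_residual \<le> 2 / (real N * (real N - 1))
      * (9 * c * D\<^sub>1\<^sup>2 + (19 / 2 + 9 / real N) * ?s)"
    using N0 by (intro mult_left_mono) simp_all
  then show ?thesis by (simp add: \<epsilon>\<^sub>N_def[abs_def])
qed

lemma integrable_\<epsilon>\<^sub>N: "integrable M \<epsilon>\<^sub>N"
  unfolding \<epsilon>\<^sub>N_def[abs_def] by (intro integrable_mult_right integrable_gap_residual)

end

section \<open>Insertion of the prescribed stepsizes\<close>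

theorem corollary3p4:
  fixes Z :: "'a::euclidean_space set"
    and G J :: "'a \<Rightarrow> real" and gradG H J' :: "'a \<Rightarrow> 'a"
    and V :: "'a \<Rightarrow> 'a \<Rightarrow> real"
    and L\<^sub>G L\<^sub>H \<sigma>\<^sub>G \<sigma>\<^sub>H \<sigma> D D' :: real
    and M :: "'w measure" and X :: "'x measure" and Y :: "'y measure"
    and \<xi> :: "nat \<Rightarrow> 'w \<Rightarrow> 'x" and \<zeta> :: "nat \<Rightarrow> 'w \<Rightarrow> 'y"
    and O\<^sub>G :: "'a \<Rightarrow> 'x \<Rightarrow> 'a" and O\<^sub>H :: "'a \<Rightarrow> 'y \<Rightarrow> 'a"
    and \<alpha> \<gamma> :: "nat \<Rightarrow> real" and N :: nat
    and r1 us :: 'a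
    and r w w_md w_ag :: "nat \<Rightarrow> 'w \<Rightarrow> 'a"
  assumes Z: "Z \<noteq> {}" "closed Z" "convex Z"
    and G_deriv: "\<And>v. v \<in> Z \<Longrightarrow> (G has_derivative (\<lambda>h. gradG v \<bullet> h)) (at v within Z)"
    and G_cont: "continuous_on Z gradG"
    and G_lower: "\<And>w v. w \<in> Z \<Longrightarrow> v \<in> Z \<Longrightarrow> 0 \<le> G w - G v - gradG v \<bullet> (w - v)"
    and G_upper: "\<And>w v. w \<in> Z \<Longrightarrow> v \<in> Z \<Longrightarrow>
        G w - G v - gradG v \<bullet> (w - v) \<le> L\<^sub>G / 2 * (norm (w - v))\<^sup>2"
    and H_mono: "\<And>w v. w \<in> Z \<Longrightarrow> v \<in> Z \<Longrightarrow> (H w - H v) \<bullet> (w - v) \<ge> 0"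
    and H_lipschitz: "\<And>w v. w \<in> Z \<Longrightarrow> v \<in> Z \<Longrightarrow> norm (H w - H v) \<le> L\<^sub>H * norm (w - v)"
    and J_convex: "convex_on Z J"
    and J_subgradient: "\<And>u. u \<in> Z \<Longrightarrow> subgradient_on Z J u (J' u)"
    and V: "\<And>r z. r \<in> Z \<Longrightarrow> z \<in> Z \<Longrightarrow> V r z = (norm (z - r))\<^sup>2 / 2"
    and prox: "prox_well_defined Z V J"
    and M: "prob_space M"
    and samples: "independent_samples M X \<xi> Y \<zeta>"
    and oracles: "unbiased_oracle Z M X \<xi> O\<^sub>G gradG" "unbiased_oracle Z M Y \<zeta> O\<^sub>H H"
    and A1: "bounded_variance Z M \<xi> O\<^sub>G gradG \<sigma>\<^sub>G" "bounded_variance Z M \<zeta> O\<^sub>H H \<sigma>\<^sub>H"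
    and solution: "strong_solution Z (\<lambda>u. gradG u + H u + J' u) us"
    and r1: "r1 \<in> Z"
    and D: "D = norm (r1 - us)"
    and \<sigma>: "\<sigma> = sqrt (\<sigma>\<^sub>H\<^sup>2 + \<sigma>\<^sub>G\<^sup>2)"
    and N: "N \<ge> 2"
    and D': "D' > 0"
    and denominator: "5 * L\<^sub>G + 3 * L\<^sub>H * N + \<sigma> * N * sqrt (real N - 1) / D' > 0"
    and \<alpha>: "\<And>t. t \<in> {1..<N} \<Longrightarrow> \<alpha> t = 2 / (real t + 1)"
    and \<gamma>: "\<And>t. t \<in> {1..<N} \<Longrightarrow>
        \<gamma> t = real t / (5 * L\<^sub>G + 3 * L\<^sub>H * N + \<sigma> * N * sqrt (real N - 1) / D')"
    and AMP: "\<And>\<omega>. \<omega> \<in> space M \<Longrightarrow>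
        stochastic_AMP Z V J O\<^sub>G O\<^sub>H \<alpha> \<gamma> N r1 (\<lambda>i. \<xi> i \<omega>) (\<lambda>i. \<zeta> i \<omega>)
          (\<lambda>t. r t \<omega>) (\<lambda>t. w t \<omega>) (\<lambda>t. w_md t \<omega>) (\<lambda>t. w_ag t \<omega>)"
  shows "\<exists>(v :: 'w \<Rightarrow> 'a) (\<epsilon> :: 'w \<Rightarrow> real).
      integrable M v \<and> integrable M \<epsilon> \<and>
      (\<forall>\<omega>\<in>space M. \<epsilon> \<omega> \<ge> 0 \<and> perturbed_gap Z G H J (w_ag N \<omega>) (v \<omega>) \<le> ereal (\<epsilon> \<omega>)) \<and>
      (\<integral>\<omega>. norm (v \<omega>) \<partial>M) \<le>
        40 * L\<^sub>G * D / (real N * (real N - 1)) + 24 * L\<^sub>H * D / (real N - 1)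
          + \<sigma> * (8 * D / D' + 5) / sqrt (real N - 1) \<and>
      (\<integral>\<omega>. \<epsilon> \<omega> \<partial>M) \<le>
        90 * L\<^sub>G * D\<^sup>2 / (real N * (real N - 1)) + 54 * L\<^sub>H * D\<^sup>2 / (real N - 1)
          + \<sigma> / sqrt (real N - 1) * (18 * D\<^sup>2 / D' + (19 + 18 / real N) * D')"
proof -
  interpret prob_space M by (rule M)
  define c where "c = 5 * L\<^sub>G + 3 * L\<^sub>H * N + \<sigma> * N * sqrt (real N - 1) / D'"
  have us: "us \<in> Z" using solution by (simp add: strong_solution_def)
  have N0: "real N > 0" "real N - 1 > 0" using N by auto
  have \<sigma>_nonneg: "0 \<le> \<sigma>" by (simp add: \<sigma>)
  have D_nonneg: "0 \<le> D" by (simp add: D)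
  show ?thesis
  proof (cases "Z = {us}")
    case True
    \<comment> \<open>the only case in which \<open>L\<^sub>G\<close> or \<open>L\<^sub>H\<close> can be negative\<close>
    have in_Z: "prox_mapping Z V J \<eta> us h = us" if "\<eta> > 0" for \<eta> h
    proof -
      interpret euclidean_prox Z V J by unfold_locales (fact J_convex V prox)+
      show ?thesis using prox_mapping_in[OF us that, of h] True by simp
    qed
    have "w_ag N \<omega> = us" if "\<omega> \<in> space M" for \<omega>
    proof -
      note run = AMP[OF that, unfolded stochastic_AMP_def]
      have "t \<le> N \<longrightarrow> w_ag t \<omega> = us \<and> r t \<omega> = us" if "1 \<le> t" for t
        using that
      proof (induction t rule: dec_induct)
        case base
        then show ?case using run r1 True by simp
      next
        case (step t)
        show ?case
        proof
          assume "Suc t \<le> N"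
          then have t: "t \<in> {1..<N}" and IH: "w_ag t \<omega> = us" "r t \<omega> = us" using step by auto
          have "\<gamma> t > 0" using \<gamma>[OF t] denominator t by simp
          then have "w (t + 1) \<omega> = us" "r (t + 1) \<omega> = us"
            using run t IH in_Z by auto
          then show "w_ag (Suc t) \<omega> = us \<and> r (Suc t) \<omega> = us"
            using run t IH by (auto simp flip: scaleR_add_left)
        qed
      qed
      then show ?thesis using N by simp
    qed
    moreover have "D = 0" using r1 True by (simp add: D)
    \<comment> \<open>The whole run stays at \<open>us\<close>, where the zero perturbation and the
      zero error suffice.\<close>
    ultimately show ?thesis
      using True N0 \<sigma>_nonneg D'
      by (intro exI[of _ "\<lambda>_. 0"]) (simp add: perturbed_gap_def gap_Q_def)
  next
    case False
    then obtain y where y: "y \<in> Z" "y \<noteq> us" using us by auto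
    \<comment> \<open>A second point in \<open>Z\<close> forces both constants to be
      nonnegative.\<close>
    have "0 \<le> L\<^sub>G / 2 * (norm (y - us))\<^sup>2"
      using G_lower[OF y(1) us] G_upper[OF y(1) us] by linarith
    then have L\<^sub>G: "0 \<le> L\<^sub>G" using y by (simp add: zero_le_mult_iff)
    have "0 \<le> L\<^sub>H * norm (y - us)"
      using H_lipschitz[OF y(1) us] norm_ge_zero[of "H y - H us"] by linarith
    then have L\<^sub>H: "0 \<le> L\<^sub>H" using y by (simp add: zero_le_mult_iff)
    \<comment> \<open>The first-order lower bounds for \<open>G\<close> and \<open>J\<close> at
      \<open>us\<close> reduce the gap to the inequality that defines a strong solution.\<close>
    have Q_us: "0 \<le> gap_Q G H J u us" if u: "u \<in> Z" for u
    proof -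
      have "J us + J' us \<bullet> (u - us) \<le> J u"
        using J_subgradient[OF us] u by (simp add: subgradient_on_def)
      moreover have "(gradG us + H us + J' us) \<bullet> (us - u) \<le> 0"
        using solution u by (simp add: strong_solution_def)
      ultimately show ?thesis
        using G_lower[OF u us] by (simp add: gap_Q_def inner_simps algebra_simps)
    qed
    let ?s = "\<sigma> * N * sqrt (real N - 1) / D'"
    have s_nonneg: "0 \<le> ?s" using \<sigma>_nonneg N0 D' by simp
    have c_facts: "0 < c" "5 * L\<^sub>G + 3 * L\<^sub>H * N \<le> c"
      using denominator s_nonneg by (simp_all add: c_def)
    have stepsize: "\<gamma> t = real t / c" if "t \<in> {1..<N}" for t
      using \<gamma>[OF that] by (simp add: c_def)
    interpret amp_run Z V J G gradG H L\<^sub>G L\<^sub>H c N M X Y \<xi> \<zeta> O\<^sub>G O\<^sub>H \<sigma>\<^sub>G \<sigma>\<^sub>H \<alpha> \<gamma> r1 us r w w_md w_ag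
      by unfold_locales (fact c_facts stepsize L\<^sub>G L\<^sub>H us Q_us assms)+
    have \<sigma>2: "\<sigma>2 = \<sigma>\<^sup>2" "sqrt \<sigma>2 = \<sigma>" by (simp_all add: \<sigma>2_def \<sigma>)
    have root: "sqrt (real N - 1) * sqrt (real N - 1) = real N - 1" "sqrt (real N - 1) > 0"
      using N0 by simp_all
    \<comment> \<open>Writing N - 1 as \<open>q * q\<close> turns the final identities into
      identities of rational functions.\<close>
    define q where "q = sqrt (real N - 1)"
    have q: "real N - 1 = q * q" "q > 0" using root by (simp_all add: q_def)
    let ?k = "2 / (real N * (real N - 1))"

    have "expectation (\<lambda>\<omega>. norm (v\<^sub>N \<omega>)) \<le> ?k * (2 * c * D + 5 / 2 * (\<sigma> * real N * sqrt (real N - 1)))"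
      using expectation_norm_v\<^sub>N_le unfolding \<sigma>2(2) D .
    \<comment> \<open>The estimate has 2 in front of \<open>c * D\<close>; the stated constants 40,
      24 and 8 correspond to 4.\<close>
    also have "\<dots> \<le> ?k * (4 * c * D + 5 / 2 * (\<sigma> * real N * sqrt (real N - 1)))"
      using N0 c_pos D_nonneg by (intro mult_left_mono) simp_all
    also have "\<dots> = 40 * L\<^sub>G * D / (real N * (real N - 1)) + 24 * L\<^sub>H * D / (real N - 1)
        + \<sigma> * (8 * D / D' + 5) / sqrt (real N - 1)"
      unfolding c_def q_def[symmetric] unfolding q(1) using q(2) N0 D' by (simp add: field_simps)
    finally have v_le: "expectation (\<lambda>\<omega>. norm (v\<^sub>N \<omega>)) \<le> 40 * L\<^sub>G * D / (real N * (real N - 1))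
        + 24 * L\<^sub>H * D / (real N - 1) + \<sigma> * (8 * D / D' + 5) / sqrt (real N - 1)" .

    \<comment> \<open>The noise term \<open>?s\<close> of the denominator acts here: the numerator
      is \<open>?s\<close> times the right-hand side, and \<open>?s\<close> is at most
      \<open>c\<close>. Thus \<open>D'\<close> trades the noise against the distance term.\<close>
    have "\<sigma>\<^sup>2 * (real N)\<^sup>2 * (real N - 1) / c \<le> \<sigma> * N * sqrt (real N - 1) * D'"
    proof -
      have "\<sigma>\<^sup>2 * (real N)\<^sup>2 * (real N - 1) = (\<sigma> * N * sqrt (real N - 1) * D') * ?s"
        using D' root(1) by (simp add: power2_eq_square)
      also have "\<dots> \<le> (\<sigma> * N * sqrt (real N - 1) * D') * c"
        using L\<^sub>G L\<^sub>H \<sigma>_nonneg D' N0 by (intro mult_left_mono) (simp_all add: c_def)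
      finally show ?thesis using c_pos by (simp add: pos_divide_le_eq)
    qed
    then have "expectation \<epsilon>\<^sub>N \<le> ?k * (9 * c * D\<^sup>2
        + (19 / 2 + 9 / real N) * (\<sigma> * N * sqrt (real N - 1) * D'))"
      using N0 unfolding D
      by (intro order_trans[OF expectation_\<epsilon>\<^sub>N_le] mult_left_mono add_left_mono)
        (simp_all add: \<sigma>2(1))
    also have "\<dots> = 90 * L\<^sub>G * D\<^sup>2 / (real N * (real N - 1)) + 54 * L\<^sub>H * D\<^sup>2 / (real N - 1)
        + \<sigma> / sqrt (real N - 1) * (18 * D\<^sup>2 / D' + (19 + 18 / real N) * D')"
      unfolding c_def q_def[symmetric] unfolding q(1) using q(2) N0 D' by (simp add: field_simps)
    finally show ?thesis
      using integrable_v\<^sub>N integrable_\<epsilon>\<^sub>N \<epsilon>\<^sub>N_nonneg perturbed_gap_le v_le by blast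
  qed
qed

end
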